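(* Let $G=(V,E)$ be a $d$-regular graph on $n$ vertices whose edge-connectivity is $k\ge 1$. Then there is an allocation strategy for the graphical process on $G$ such that for every constant $c>0$ there is a constant $C=C(c)$ (independent of $G$ and of $t$) with the following property: for every time $t\in\mathbb{N}$, \[\Pr\Big[\mathrm{gap}_G(t) \le C\,\tfrac{d}{k}\,\log^4 n\,\log\log n\Big]\ \ge\ 1-O(n^{-c}).\]
   Context: Graphical balls-into-bins process on $G=(V,E)$: at each time $t=1,2,\dots$ an edge of $E$ is chosen uniformly at random, independently of the past, and a ball must be placed on one of its two endpoints. An allocation strategy is a rule that decides, given the requested edge and the whole history so far (and possibly independent extra randomness), on which endpoint to place the ball. $L^t(v)$ denotes the number of balls on vertex $v$ after $t$ steps, with $L^0\equiv 0$, and $\mathrm{gap}_G(t)=\max_{u\in V}L^t(u)-\min_{u\in V}L^t(u)$. The edge-connectivity $k$ of $G$ is the minimum number of edges whose removal disconnects $G$. "With probability $1-1/\mathrm{poly}(n)$" in the paper is rendered here as $1-O(n^{-c})$ for an arbitrary constant $c$. *)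

theory Defs
  imports "HOL-Probability.Probability"
begin

definition simple_graph :: "'a set \<Rightarrow> 'a set set \<Rightarrow> bool" where
  "simple_graph V E \<longleftrightarrow> finite V \<and> (\<forall>e\<in>E. e \<subseteq> V \<and> card e = 2)"

definition regular_graph :: "'a set \<Rightarrow> 'a set set \<Rightarrow> nat \<Rightarrow> bool" where
  "regular_graph V E d \<longleftrightarrow> (\<forall>v\<in>V. card {e \<in> E. v \<in> e} = d)"

definition connected_graph :: "'a set \<Rightarrow> 'a set set \<Rightarrow> bool" where
  "connected_graph V E \<longleftrightarrow> (\<forall>u\<in>V. \<forall>v\<in>V. (u, v) \<in> {(x, y). {x, y} \<in> E}\<^sup>*)"

text \<open>
  A graph with at most one vertex cannot be disconnected by removing edges; by the usual
  convention its edge-connectivity is \<open>0\<close>.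
\<close>
definition edge_connectivity :: "'a set \<Rightarrow> 'a set set \<Rightarrow> nat" where
  "edge_connectivity V E =
     (if card V \<le> 1 then 0
      else (LEAST j. \<exists>F\<subseteq>E. card F = j \<and> \<not> connected_graph V (E - F)))"

text \<open>
  A history lists, in chronological order, the requested edges together with the endpoints
  that received the balls.
\<close>
type_synonym 'a history = "('a set \<times> 'a) list"

text \<open>
  A strategy maps the history and the current request to the distribution of the chosen
  endpoint; the distribution captures the fresh randomness of the strategy, and deterministic
  rules are those with values of the form \<open>return_pmf v\<close>.
\<close>
type_synonym 'a strategy = "'a history \<Rightarrow> 'a set \<Rightarrow> 'a pmf"

definition allocation_strategy :: "'a set set \<Rightarrow> 'a strategy \<Rightarrow> bool" where
  "allocation_strategy E S \<longleftrightarrow> (\<forall>h. \<forall>e\<in>E. set_pmf (S h e) \<subseteq> e)"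

text \<open>
  The law of the history after a given number of steps. It is meaningful only for finite
  nonempty \<open>E\<close>, where \<open>pmf_of_set E\<close> is the uniform distribution.
\<close>
primrec process :: "'a set set \<Rightarrow> 'a strategy \<Rightarrow> nat \<Rightarrow> 'a history pmf" where
  "process E S 0 = return_pmf []"
| "process E S (Suc t) =
     do {
       h \<leftarrow> process E S t;
       e \<leftarrow> pmf_of_set E;
       v \<leftarrow> S h e;
       return_pmf (h @ [(e, v)])
     }"

definition load :: "'a history \<Rightarrow> 'a \<Rightarrow> nat" where
  "load h v = count_list (map snd h) v"

definition gap :: "'a set \<Rightarrow> 'a history \<Rightarrow> nat" where
  "gap V h = Max (load h ` V) - Min (load h ` V)"

end

(*
  Assigning each requested edge a bias routes a flow, in expectation, of capacity 1/2 per edge;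
  the random requests are noise that this flow has to drain.

  Every partition of V into c parts is crossed by at least ck/2 edges, so each edge weighting
  has a spanning set of relative weight at most 2/k.  Repeatedly choosing one that is light for
  the weights 2^load packs N = k|E| spanning sets with O(N/k) of them through each edge.  Each
  spanning set is traversed by a closed walk that uses its edges at most twice, so it acts as a
  line through V, and each line receives the share 1/N of the noise.

  On a line, the Haar functions of the dyadic blocks diagonalise the problem: the flow routing one
  Haar function changes only the coefficient of that function, and the flows of one level use
  disjoint parts of the line.  Hence every coefficient can be driven towards 0 by a flow of constant
  size and the sign of the coefficient, and is a one-dimensional walk with drift towards 0.
  An exponential potential gives exponential tails of scale O((d/k) log n), uniformly in time.
  The deviation of a load from its mean is a sum of O(log n) coefficients, averaged over the lines;
  this gives a gap of O((d/k) log^3 n).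
*)

theory Submission imports Defs begin

section \<open>Packing spanning sets\<close>

definition crosses :: "'a set \<Rightarrow> 'a set \<Rightarrow> bool" where
  "crosses S e \<longleftrightarrow> e \<inter> S \<noteq> {} \<and> e - S \<noteq> {}"

text \<open>This is connectivity of \<open>(V, F)\<close> stated through cuts, the form that suits
  both merging parts and enlarging a visited set.\<close>

definition spanning :: "'a set \<Rightarrow> 'a set set \<Rightarrow> bool" where
  "spanning V F \<longleftrightarrow> (\<forall>S. S \<subseteq> V \<and> S \<noteq> {} \<and> S \<noteq> V \<longrightarrow> (\<exists>e\<in>F. crosses S e))"

section \<open>Cuts, light spanning sets and their packing\<close>

lemma simple_graph_finite_edges:
  assumes "simple_graph V E" shows "finite E"
  using assms finite_subset[of E "Pow V"] by (auto simp: simple_graph_def)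

text \<open>Once the edges crossing \<open>S\<close> are removed, no path leaves \<open>S\<close>;
  they are therefore one of the disconnecting sets over which the minimum is taken.\<close>

lemma edge_connectivity_le_cut:
  assumes G: "simple_graph V E" and "edge_connectivity V E = k" "k \<ge> 1"
    and S: "S \<subseteq> V" "S \<noteq> {}" "S \<noteq> V"
  shows "k \<le> card {e \<in> E. crosses S e}"
proof -
  define F where "F = {e \<in> E. crosses S e}"
  obtain u v where uv: "u \<in> S" "v \<in> V" "v \<notin> S" using S by blast
  have "y \<in> S" if "(u, y) \<in> {(x, y). {x, y} \<in> E - F}\<^sup>*" for y
    using that
  proof (induction rule: rtrancl_induct)
    case base
    then show ?case using uv by simp
  next
    case (step y z)
    then show ?case by (auto simp: F_def crosses_def)
  qed
  then have "\<not> connected_graph V (E - F)"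
    using uv S by (auto simp: connected_graph_def)
  moreover have "F \<subseteq> E" by (auto simp: F_def)
  ultimately have "(LEAST j. \<exists>F\<subseteq>E. card F = j \<and> \<not> connected_graph V (E - F)) \<le> card F"
    by (intro Least_le) blast
  moreover have "edge_connectivity V E = (LEAST j. \<exists>F\<subseteq>E. card F = j \<and> \<not> connected_graph V (E - F))"
    using assms(2,3) by (auto simp: edge_connectivity_def split: if_splits)
  ultimately show ?thesis using assms(2) by (simp add: F_def)
qed

locale cut_graph =
  fixes V :: "'a set" and E :: "'a set set" and k :: nat
  assumes simple: "simple_graph V E" and nonempty: "V \<noteq> {}" and k_pos: "k \<ge> 1"
    and cut: "\<And>S. S \<subseteq> V \<Longrightarrow> S \<noteq> {} \<Longrightarrow> S \<noteq> V \<Longrightarrow> k \<le> card {e \<in> E. crosses S e}"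
begin

lemma finite_V: "finite V" and finite_E: "finite E"
  using simple simple_graph_finite_edges by (auto simp: simple_graph_def)

lemma edge_subset: "e \<in> E \<Longrightarrow> e \<subseteq> V" and card_edge: "e \<in> E \<Longrightarrow> card e = 2"
  using simple by (auto simp: simple_graph_def)

text \<open>The fibres of \<open>\<phi>\<close> are the parts. Each part is left by at least
  \<open>k\<close> edges, and an edge between parts is counted at exactly two of them.\<close>

lemma card_crossing_partition:
  fixes \<phi> :: "'a \<Rightarrow> 'b"
  assumes "card (\<phi> ` V) \<ge> 2"
  shows "k * card (\<phi> ` V) \<le> 2 * card {e \<in> E. card (\<phi> ` e) = 2}"
proof -
  define X where "X = {e \<in> E. card (\<phi> ` e) = 2}"
  have "k \<le> card {e \<in> X. l \<in> \<phi> ` e}" if l: "l \<in> \<phi> ` V" for l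
  proof -
    define S where "S = {v \<in> V. \<phi> v = l}"
    have "S \<noteq> V"
    proof
      assume "S = V"
      then have "\<phi> ` V \<subseteq> {l}" by (auto simp: S_def)
      then have "card (\<phi> ` V) \<le> card {l}" by (intro card_mono) auto
      then show False using assms by simp
    qed
    then have "k \<le> card {e \<in> E. crosses S e}"
      using l by (intro cut) (auto simp: S_def)
    also have "{e \<in> E. crosses S e} \<subseteq> {e \<in> X. l \<in> \<phi> ` e}"
    proof safe
      fix e assume e: "e \<in> E" "crosses S e"
      obtain x y where xy: "e = {x, y}" "x \<noteq> y" using card_edge[OF e(1)] by (auto simp: card_2_iff)
      show "l \<in> \<phi> ` e" using e by (auto simp: crosses_def S_def)
      have "\<phi> x \<noteq> \<phi> y" using e edge_subset[OF e(1)] by (auto simp: crosses_def S_def xy)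
      then show "e \<in> X" using e by (auto simp: X_def xy)
    qed
    then have "card {e \<in> E. crosses S e} \<le> card {e \<in> X. l \<in> \<phi> ` e}"
      by (intro card_mono) (auto simp: X_def finite_E)
    finally show ?thesis .
  qed
  then have "card (\<phi> ` V) * k \<le> (\<Sum>l\<in>\<phi> ` V. card {e \<in> X. l \<in> \<phi> ` e})"
    by (intro sum_bounded_below[of _ k, simplified]) auto
  also have "\<dots> = 2 * card X"
  proof (rule sum_multicount)
    have "{l \<in> \<phi> ` V. l \<in> \<phi> ` e} = \<phi> ` e" if "e \<in> X" for e
      using that edge_subset by (auto simp: X_def)
    then show "\<forall>e\<in>X. card {l \<in> \<phi> ` V. l \<in> \<phi> ` e} = 2" by (auto simp: X_def)
  qed (auto simp: X_def finite_E finite_V)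
  finally show ?thesis by (simp add: X_def mult.commute)
qed

text \<open>These sets are unions of parts, that is, the cuts that survive contracting each part to
  a point.\<close>

definition saturated_cut :: "('a \<Rightarrow> 'b) \<Rightarrow> 'a set \<Rightarrow> bool" where
  "saturated_cut \<phi> S \<longleftrightarrow> S \<subseteq> V \<and> S \<noteq> {} \<and> S \<noteq> V \<and>
     (\<forall>x\<in>V. \<forall>y\<in>V. \<phi> x = \<phi> y \<longrightarrow> (x \<in> S \<longleftrightarrow> y \<in> S))"

text \<open>A local-ratio argument, by induction on the number of parts: take a lightest crossing
  edge \<open>e0\<close>, subtract its weight from all edges, and merge the two parts it joins. The
  bound \<open>card F \<le> c\<close> limits what undoing the subtraction costs, while
  \<open>card_crossing_partition\<close> shows how much total weight was subtracted. Only crossing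
  edges need weight at least 0, as the subtraction may make others negative.\<close>

lemma light_spanning_set_contracted:
  fixes \<phi> :: "'a \<Rightarrow> 'b" and w :: "'a set \<Rightarrow> real"
  assumes "card (\<phi> ` V) = Suc c" and "\<And>e. e \<in> E \<Longrightarrow> card (\<phi> ` e) = 2 \<Longrightarrow> w e \<ge> 0"
  shows "\<exists>F. F \<subseteq> {e \<in> E. card (\<phi> ` e) = 2} \<and> card F \<le> c \<and>
     (\<forall>S. saturated_cut \<phi> S \<longrightarrow> (\<exists>e\<in>F. crosses S e)) \<and>
     real k * sum w F \<le> 2 * sum w {e \<in> E. card (\<phi> ` e) = 2}"
  using assms
proof (induction c arbitrary: \<phi> w)
  case 0
  then obtain l where "\<phi> ` V = {l}" by (auto simp: card_1_singleton_iff)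
  then have const: "\<phi> x = \<phi> y" if "x \<in> V" "y \<in> V" for x y
    using that by (metis imageI singletonD)
  have "\<not> saturated_cut \<phi> S" for S
  proof
    assume S: "saturated_cut \<phi> S"
    then obtain x y where "x \<in> S" "y \<in> V" "y \<notin> S" unfolding saturated_cut_def by blast
    then show False using const[of x y] S unfolding saturated_cut_def by blast
  qed
  moreover have "0 \<le> sum w {e \<in> E. card (\<phi> ` e) = 2}" using 0(2) by (intro sum_nonneg) simp
  ultimately show ?case by (intro exI[of _ "{}"]) auto
next
  case (Suc c)
  define X where "X = {e \<in> E. card (\<phi> ` e) = 2}"
  have finX: "finite X" by (auto simp: X_def finite_E)
  have cX: "k * (c + 2) \<le> 2 * card X"
    using card_crossing_partition[of \<phi>] Suc.prems(1) by (simp add: X_def)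
  then have "X \<noteq> {}" using k_pos by auto
  then obtain e0 where e0: "e0 \<in> X" "\<And>e. e \<in> X \<Longrightarrow> w e0 \<le> w e"
    using finX by (metis arg_min_if_finite(1) arg_min_least)
  have w0: "w e0 \<ge> 0" using e0(1) Suc.prems(2) by (auto simp: X_def)
  have e0E: "e0 \<in> E" using e0 by (auto simp: X_def)
  obtain x0 y0 where xy: "e0 = {x0, y0}" using card_edge[OF e0E] by (auto simp: card_2_iff)
  have ne: "\<phi> x0 \<noteq> \<phi> y0" using e0(1) by (auto simp: X_def xy)
  have xyV: "x0 \<in> V" "y0 \<in> V" using edge_subset[OF e0E] by (auto simp: xy)
  \<comment> \<open>The part of \<open>x0\<close> is relabelled as the part of
    \<open>y0\<close>.\<close>
  define \<psi> where "\<psi> = (\<lambda>v. if \<phi> v = \<phi> x0 then \<phi> y0 else \<phi> v)"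
  define w' where "w' = (\<lambda>e. w e - w e0)"
  define X' where "X' = {e \<in> E. card (\<psi> ` e) = 2}"
  have "\<psi> ` V = \<phi> ` V - {\<phi> x0}" using xyV ne by (auto simp: \<psi>_def image_iff)
  then have card': "card (\<psi> ` V) = Suc c" using Suc.prems(1) xyV by (simp add: finite_V)
  have X'X: "X' \<subseteq> X"
  proof
    fix e assume e: "e \<in> X'"
    have "card e = 2" using e card_edge by (auto simp: X'_def)
    then obtain x y where xy: "e = {x, y}" by (auto simp: card_2_iff)
    have "\<psi> x \<noteq> \<psi> y" using e by (auto simp: X'_def xy)
    then have "\<phi> x \<noteq> \<phi> y" unfolding \<psi>_def by metis
    then show "e \<in> X" using e by (auto simp: X_def X'_def xy)
  qed
  have "\<exists>F. F \<subseteq> X' \<and> card F \<le> c \<and>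
     (\<forall>S. saturated_cut \<psi> S \<longrightarrow> (\<exists>e\<in>F. crosses S e)) \<and>
     real k * sum w' F \<le> 2 * sum w' X'"
    unfolding X'_def
  proof (rule Suc.IH[OF card'])
    fix e assume "e \<in> E" "card (\<psi> ` e) = 2"
    then have "e \<in> X" using X'X by (auto simp: X'_def)
    then show "0 \<le> w' e" using e0 by (simp add: w'_def)
  qed
  then obtain F where F: "F \<subseteq> X'" "card F \<le> c"
     "\<And>S. saturated_cut \<psi> S \<Longrightarrow> \<exists>e\<in>F. crosses S e"
     "real k * sum w' F \<le> 2 * sum w' X'" by blast
  have finF: "finite F" using finite_subset[OF subset_trans[OF F(1) X'X] finX] .
  have "sum w (insert e0 F) \<le> w e0 + sum w F"
    using w0 finF by (cases "e0 \<in> F") (auto simp: insert_absorb)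
  moreover have "sum w F = sum w' F + card F * w e0"
    by (simp add: w'_def sum_subtractf)
  moreover have "card F * w e0 \<le> c * w e0"
    using F(2) w0 by (intro mult_right_mono) auto
  ultimately have "k * sum w (insert e0 F) \<le> k * (w e0 + sum w' F + c * w e0)"
    by (intro mult_left_mono) auto
  also have "\<dots> = k * sum w' F + real (k * (c + 2)) * w e0 - k * w e0" by (simp add: algebra_simps)
  \<comment> \<open>The slack \<open>k * w e0\<close> is dropped. By \<open>cX\<close>, the
    remaining cost of \<open>w e0\<close> is covered by its subtraction from each of the
    \<open>card X\<close> crossing edges.\<close>
  also have "\<dots> \<le> 2 * sum w' X' + real (2 * card X) * w e0 - 0"
    using cX w0 F(4) by (intro diff_mono add_mono mult_right_mono) (simp_all only: of_nat_le_iff, auto)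
  also have "sum w' X' \<le> sum w' X"
    using X'X e0 finX by (intro sum_mono2) (auto simp: w'_def)
  also have "2 * sum w' X + real (2 * card X) * w e0 - 0 = 2 * sum w X"
    by (simp add: w'_def sum_subtractf algebra_simps)
  finally have weight: "k * sum w (insert e0 F) \<le> 2 * sum w X" by simp
  show ?case
  proof (intro exI[of _ "insert e0 F"] conjI allI impI)
    show "insert e0 F \<subseteq> {e \<in> E. card (\<phi> ` e) = 2}" using F(1) X'X e0 by (auto simp: X_def)
    show "card (insert e0 F) \<le> Suc c" using F(2) finF by (simp add: card_insert_if)
    show "real k * sum w (insert e0 F) \<le> 2 * sum w {e \<in> E. card (\<phi> ` e) = 2}"
      using weight by (simp add: X_def)
  next
    fix S assume S: "saturated_cut \<phi> S"
    show "\<exists>e\<in>insert e0 F. crosses S e"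
    proof (cases "crosses S e0")
      case False
      \<comment> \<open>If \<open>e0\<close> does not cross \<open>S\<close>, then \<open>S\<close>
        is also a union of the merged parts, and the induction hypothesis supplies the edge.\<close>
      then have same: "x0 \<in> S \<longleftrightarrow> y0 \<in> S" by (auto simp: crosses_def xy)
      have "\<exists>e\<in>F. crosses S e"
      proof (rule F(3))
        have "x \<in> S \<longleftrightarrow> y \<in> S" if xy': "x \<in> V" "y \<in> V" and eq: "\<psi> x = \<psi> y" for x y
        proof -
          have S': "u \<in> S \<longleftrightarrow> v \<in> S" if "u \<in> V" "v \<in> V" "\<phi> u = \<phi> v" for u v
            using S that unfolding saturated_cut_def by blast
          consider "\<phi> x = \<phi> y" | "\<phi> x = \<phi> x0" "\<phi> y = \<phi> y0" | "\<phi> x = \<phi> y0" "\<phi> y = \<phi> x0"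
            using eq unfolding \<psi>_def by metis
          then show ?thesis using S'[of x y] S'[of x x0] S'[of y y0] S'[of x y0] S'[of y x0] xy' xyV same
            by cases simp_all
        qed
        then show "saturated_cut \<psi> S" using S unfolding saturated_cut_def by blast
      qed
      then show ?thesis by blast
    qed blast
  qed
qed

lemma light_spanning_set:
  fixes w :: "'a set \<Rightarrow> real"
  assumes "\<And>e. e \<in> E \<Longrightarrow> w e \<ge> 0"
  obtains F where "F \<subseteq> E" "spanning V F" "real k * sum w F \<le> 2 * sum w E"
proof -
  have "card V > 0" using finite_V nonempty by (simp add: card_gt_0_iff)
  then have "card (id ` V) = Suc (card V - 1)" by simp
  from light_spanning_set_contracted[where w = w, OF this]
  obtain F where F: "F \<subseteq> {e \<in> E. card (id ` e) = 2}" "\<forall>S. saturated_cut id S \<longrightarrow> (\<exists>e\<in>F. crosses S e)"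
    "real k * sum w F \<le> 2 * sum w {e \<in> E. card (id ` e) = 2}"
    using assms by (elim meta_impE exE conjE) auto
  have "{e \<in> E. card (id ` e) = 2} = E" using card_edge by auto
  then show ?thesis
    using that[of F] F by (auto simp: spanning_def saturated_cut_def)
qed

text \<open>Multiplicative weights: adding a spanning set \<open>H\<close> doubles the weight
  \<open>2 ^ load\<close> of its edges, so the total grows by the weight of \<open>H\<close>, which
  is at most a fraction \<open>2 / k\<close> if \<open>H\<close> is light.\<close>

lemma spanning_packing_potential:
  "\<exists>F. (\<forall>i<N. F i \<subseteq> E \<and> spanning V (F i)) \<and>
     (\<Sum>e\<in>E. 2 ^ card {i. i < N \<and> e \<in> F i}) \<le> real (card E) * (1 + 2 / k) ^ N"
proof (induction N)
  case (Suc N)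
  then obtain F where F: "\<forall>i<N. F i \<subseteq> E \<and> spanning V (F i)"
    "(\<Sum>e\<in>E. 2 ^ card {i. i < N \<and> e \<in> F i}) \<le> real (card E) * (1 + 2 / k) ^ N" by blast
  define w :: "'a set \<Rightarrow> real" where "w = (\<lambda>e. 2 ^ card {i. i < N \<and> e \<in> F i})"
  obtain H where H: "H \<subseteq> E" "spanning V H" "real k * sum w H \<le> 2 * sum w E"
    using light_spanning_set[of w] by (auto simp: w_def)
  define F' where "F' = F(N := H)"
  have *: "(2::real) ^ card {i. i < Suc N \<and> e \<in> F' i} = w e + (if e \<in> H then w e else 0)" for e
  proof -
    have "{i. i < Suc N \<and> e \<in> F' i} = {i. i < N \<and> e \<in> F i} \<union> (if e \<in> H then {N} else {})"
      by (auto simp: F'_def less_Suc_eq)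
    then show ?thesis by (auto simp: w_def)
  qed
  have "(\<Sum>e\<in>E. (2::real) ^ card {i. i < Suc N \<and> e \<in> F' i}) = sum w E + sum w H"
    using H(1) by (simp add: * sum.distrib sum.If_cases finite_E Int_absorb1)
  also have "sum w H \<le> 2 / k * sum w E" using H(3) k_pos by (simp add: field_simps)
  also have "sum w E + 2 / k * sum w E = (1 + 2 / k) * sum w E" by (simp add: algebra_simps)
  also have "\<dots> \<le> (1 + 2 / k) * (real (card E) * (1 + 2 / k) ^ N)"
    using F(2) by (intro mult_left_mono) (auto simp: w_def)
  finally show ?case
    using F(1) H by (intro exI[of _ F']) (auto simp: F'_def less_Suc_eq algebra_simps)
qed auto

text \<open>After \<open>k * m\<close> rounds the potential is at most
  \<open>m * exp (2 * m)\<close>, hence at most \<open>2 ^ (5 * m)\<close> by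
  \<open>m \<le> 2 ^ m\<close> and \<open>exp 2 \<le> 2 ^ 4\<close>. A single edge contributes
  \<open>2 ^ load\<close>, so its load is at most \<open>5 * m\<close>.\<close>

lemma spanning_packing:
  obtains F where "\<And>i. i < k * card E \<Longrightarrow> F i \<subseteq> E" "\<And>i. i < k * card E \<Longrightarrow> spanning V (F i)"
    "\<And>e. e \<in> E \<Longrightarrow> card {i. i < k * card E \<and> e \<in> F i} \<le> 5 * card E"
proof -
  define m N where "m = card E" and "N = k * m"
  obtain F where F: "\<forall>i<N. F i \<subseteq> E \<and> spanning V (F i)"
    "(\<Sum>e\<in>E. 2 ^ card {i. i < N \<and> e \<in> F i}) \<le> real m * (1 + 2 / k) ^ N"
    using spanning_packing_potential[of N] unfolding m_def by blast
  have "card {i. i < N \<and> e \<in> F i} \<le> 5 * m" if e: "e \<in> E" for e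
  proof -
    have "(2::real) ^ card {i. i < N \<and> e \<in> F i} \<le> (\<Sum>e\<in>E. 2 ^ card {i. i < N \<and> e \<in> F i})"
      using e finite_E by (intro member_le_sum) auto
    also have "\<dots> \<le> real m * (1 + 2 / k) ^ N" by (rule F)
    also have "\<dots> \<le> 2 ^ m * exp (2 / k) ^ N"
      by (intro mult_mono power_mono exp_ge_add_one_self)
         (auto simp: less_imp_le of_nat_less_two_power add_nonneg_nonneg)
    also have "exp (2 / k) ^ N = exp (2::real) ^ m"
      using k_pos by (simp add: N_def flip: exp_of_nat_mult)
    also have "exp (2::real) \<le> 16"
    proof -
      have "exp (2::real) = exp 1 * exp 1" by (simp flip: exp_add)
      also have "\<dots> \<le> 3 * 3" by (intro mult_mono exp_le) auto
      finally show ?thesis by simp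
    qed
    then have "2 ^ m * exp (2::real) ^ m \<le> 2 ^ m * (2 ^ 4) ^ m"
      by (intro mult_left_mono power_mono) auto
    also have "\<dots> = 2 ^ (5 * m)" by (simp only: power_mult[symmetric] power_add[symmetric]) simp
    finally show ?thesis by (simp only: power_increasing_iff)
  qed
  then show ?thesis using that[of F] F(1) by (auto simp: N_def m_def)
qed

end

section \<open>Walks through spanning sets\<close>

definition walk_edges :: "'a list \<Rightarrow> 'a set list" where
  "walk_edges W = map2 (\<lambda>x y. {x, y}) W (tl W)"

lemma length_walk_edges [simp]: "length (walk_edges W) = length W - 1"
  by (simp add: walk_edges_def)

lemma walk_edges_nth: "Suc j < length W \<Longrightarrow> walk_edges W ! j = {W ! j, W ! Suc j}"
  by (simp add: walk_edges_def nth_tl)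

lemma walk_edges_Cons [simp]: "walk_edges (x # y # zs) = {x, y} # walk_edges (y # zs)"
  and walk_edges_singleton [simp]: "walk_edges [x] = []"
  by (auto simp: walk_edges_def)

lemma walk_edges_append:
  "walk_edges (xs @ u # ys) = walk_edges (xs @ [u]) @ walk_edges (u # ys)"
proof (induction xs)
  case (Cons x xs)
  then show ?case by (cases xs) auto
qed simp

text \<open>The walk starts at one vertex and grows by detours \<open>u, v, u\<close> along an edge
  of \<open>F\<close> that leaves the visited set. Each detour uses a fresh edge twice and adds one
  new vertex and two entries.\<close>

lemma spanning_walk:
  assumes "finite V" "V \<noteq> {}" and F: "spanning V F" "\<And>e. e \<in> F \<Longrightarrow> e \<subseteq> V \<and> card e = 2"
  obtains W where "set W = V" "length W < 2 * card V" "set (walk_edges W) \<subseteq> F"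
    "\<And>e. count_list (walk_edges W) e \<le> 2"
proof -
  have "\<exists>W. set W \<subseteq> V \<and> card (set W) = Suc j \<and> length W < 2 * Suc j \<and> set (walk_edges W) \<subseteq> F
    \<and> (\<forall>e. count_list (walk_edges W) e \<le> 2)" if "j < card V" for j
    using that
  proof (induction j)
    case 0
    obtain x where "x \<in> V" using assms by blast
    then show ?case by (intro exI[of _ "[x]"]) auto
  next
    case (Suc j)
    then obtain W where W: "set W \<subseteq> V" "card (set W) = Suc j" "length W < 2 * Suc j"
      "set (walk_edges W) \<subseteq> F" "\<And>e. count_list (walk_edges W) e \<le> 2" by auto
    have "set W \<noteq> V" "set W \<noteq> {}" using W(2) Suc.prems by auto
    then obtain e where e: "e \<in> F" "crosses (set W) e"
      using F(1) W(1) by (auto simp: spanning_def)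
    then obtain u v where uv: "u \<in> e" "u \<in> set W" "v \<in> e" "v \<notin> set W" by (auto simp: crosses_def)
    have e_eq: "e = {u, v}" "v \<in> V" "u \<noteq> v" using F(2)[OF e(1)] uv by (auto simp: card_2_iff)
    obtain xs ys where xs: "W = xs @ u # ys" using uv split_list by metis
    define W' where "W' = xs @ u # v # u # ys"
    have edges: "walk_edges W' = walk_edges (xs @ [u]) @ [e, e] @ walk_edges (u # ys)"
      using walk_edges_append[of xs u "v # u # ys"] e_eq by (simp add: W'_def insert_commute)
    have edges0: "walk_edges W = walk_edges (xs @ [u]) @ walk_edges (u # ys)"
      unfolding xs by (rule walk_edges_append)
    \<comment> \<open>All edges used so far have both endpoints in \<open>set W\<close>, whereas
      \<open>v\<close> is new.\<close>
    have "e \<notin> set (walk_edges W)"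
    proof
      assume "e \<in> set (walk_edges W)"
      then obtain j where "Suc j < length W" "e = {W ! j, W ! Suc j}"
        using walk_edges_nth by (fastforce simp: in_set_conv_nth less_diff_conv)
      then have "e \<subseteq> set W" by auto
      then show False using uv e_eq by auto
    qed
    then have "count_list (walk_edges W) e = 0" by (simp add: count_list_0_iff)
    then have cnt: "count_list (walk_edges W') e' \<le> 2" for e'
      using W(5)[of e'] by (auto simp: edges edges0)
    have sub: "set (walk_edges W') \<subseteq> F" using W(4) e(1) by (simp add: edges edges0)
    have len: "length W' = length W + 2" by (simp add: W'_def xs)
    have "set W' = insert v (set W)" by (auto simp: W'_def xs)
    then show ?case using W uv e_eq(2) cnt sub len by (intro exI[of _ W']) simp
  qed
  from this[of "card V - 1"] obtain W where W: "set W \<subseteq> V" "card (set W) = card V"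
    "length W < 2 * card V" "set (walk_edges W) \<subseteq> F" "\<And>e. count_list (walk_edges W) e \<le> 2"
    using assms by (auto simp: card_gt_0_iff)
  have "set W = V" using W assms card_subset_eq by metis
  then show ?thesis using that W by blast
qed

section \<open>Haar functions on a numbered set\<close>

text \<open>The numbers will be positions of first visits on a walk, so they may have gaps. Dyadic
  blocks can therefore be empty or have halves of different size.\<close>

locale numbered_set =
  fixes V :: "'a set" and \<tau> :: "'a \<Rightarrow> nat"
  assumes finite_V: "finite V" and inj: "inj_on \<tau> V"
begin

definition block :: "nat \<Rightarrow> nat \<Rightarrow> 'a set" where
  "block j b = {v \<in> V. \<tau> v div 2 ^ j = b}"

text \<open>The difference of the uniform distributions on the two halves of a block of level
  \<open>Suc j\<close>, so that it has mean zero even when the halves differ in size. It is set to 0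
  if a half is empty, since no such difference exists then.\<close>

definition haar :: "nat \<Rightarrow> nat \<Rightarrow> 'a \<Rightarrow> real" where
  "haar j b v =
     (if block j (2 * b) = {} \<or> block j (2 * b + 1) = {} then 0
      else indicator (block j (2 * b)) v / card (block j (2 * b))
         - indicator (block j (2 * b + 1)) v / card (block j (2 * b + 1)))"

text \<open>The squared norm of the Haar function when both halves are nonempty. If exactly one half
  is empty, \<open>1 / 0 = 0\<close> leaves a positive value although the function vanishes.\<close>

definition haar_norm :: "nat \<Rightarrow> nat \<Rightarrow> real" where
  "haar_norm j b = 1 / card (block j (2 * b)) + 1 / card (block j (2 * b + 1))"

lemma finite_block [simp]: "finite (block j b)"
  by (simp add: block_def finite_V)

lemma block_subset: "block j b \<subseteq> V"
  by (auto simp: block_def)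

lemma card_block_pos: "block j b \<noteq> {} \<Longrightarrow> real (card (block j b)) \<ge> 1"
  by (metis card_gt_0_iff finite_block of_nat_1 of_nat_le_iff Suc_leI One_nat_def)

lemma disjoint_blocks: "b \<noteq> c \<Longrightarrow> block j b \<inter> block j c = {}"
  by (auto simp: block_def)

lemma block_Suc: "block (Suc j) b = block j (2 * b) \<union> block j (2 * b + 1)"
proof -
  have "x div 2 ^ Suc j = b \<longleftrightarrow> x div 2 ^ j = 2 * b \<or> x div 2 ^ j = 2 * b + 1" for x
  proof -
    have "x div 2 ^ Suc j = x div 2 ^ j div 2" by (simp add: div_mult2_eq power_Suc2 del: power_Suc)
    then show ?thesis by linarith
  qed
  then show ?thesis unfolding block_def by blast
qed

lemma haar_norm_nonneg: "haar_norm j b \<ge> 0"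
  by (simp add: haar_norm_def)

lemma haar_norm_le: "haar_norm j b \<le> 2"
proof -
  have "1 / real (card (block j c)) \<le> 1" for c
    using card_block_pos[of j c] by (cases "block j c = {}") (auto simp: field_simps)
  from add_mono[OF this this] show ?thesis by (simp add: haar_norm_def)
qed

lemma haar_outside: "v \<in> V \<Longrightarrow> \<tau> v div 2 ^ Suc j \<noteq> b \<Longrightarrow> haar j b v = 0"
  using block_Suc[of j b] by (auto simp: haar_def block_def indicator_def)

lemma sum_haar_subset:
  assumes "U \<subseteq> V" "block j (2 * b) \<noteq> {}" "block j (2 * b + 1) \<noteq> {}"
  shows "(\<Sum>v\<in>U. haar j b v) =
    card (U \<inter> block j (2 * b)) / card (block j (2 * b))
    - card (U \<inter> block j (2 * b + 1)) / card (block j (2 * b + 1))"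
proof -
  have "finite U" using assms finite_V finite_subset by metis
  then have "(\<Sum>v\<in>U. indicator A v / c) = card (U \<inter> A) / c" for A :: "'a set" and c :: real
    by (simp add: sum_divide_distrib[symmetric] indicator_def sum.If_cases Int_def)
  then show ?thesis using assms by (simp add: haar_def sum_subtractf)
qed

lemma sum_haar: "(\<Sum>v\<in>V. haar j b v) = 0"
proof (cases "block j (2 * b) = {} \<or> block j (2 * b + 1) = {}")
  case False
  then show ?thesis
    using sum_haar_subset[of V j b] block_subset[of j] by (simp add: Int_absorb1)
qed (simp add: haar_def)

lemma abs_haar_le: "\<bar>haar j b v\<bar> \<le> 1" and abs_haar_le_norm: "\<bar>haar j b v\<bar> \<le> haar_norm j b"
proof -
  have le1: "1 / real (card (block j c)) \<le> 1" if "block j c \<noteq> {}" for c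
    using card_block_pos[OF that] by (simp add: field_simps)
  have "\<bar>haar j b v\<bar> \<le> 1 \<and> \<bar>haar j b v\<bar> \<le> haar_norm j b"
    using le1[of "2 * b"] le1[of "2 * b + 1"] disjoint_blocks[of "2 * b" "2 * b + 1" j]
    by (auto simp: haar_def haar_norm_def indicator_def)
  then show "\<bar>haar j b v\<bar> \<le> 1" "\<bar>haar j b v\<bar> \<le> haar_norm j b" by auto
qed

lemma sum_haar_square_le: "(\<Sum>v\<in>V. (haar j b v)\<^sup>2) \<le> haar_norm j b"
proof (cases "block j (2 * b) = {} \<or> block j (2 * b + 1) = {}")
  case False
  define A B where "A = block j (2 * b)" and "B = block j (2 * b + 1)"
  have AB: "A \<inter> B = {}" "A \<subseteq> V" "B \<subseteq> V" "A \<noteq> {}" "B \<noteq> {}"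
    using False disjoint_blocks[of "2 * b" "2 * b + 1" j] block_subset by (auto simp: A_def B_def)
  have sq: "(haar j b v)\<^sup>2 = indicator A v / (card A)\<^sup>2 + indicator B v / (card B)\<^sup>2" for v
    using False AB(1) by (auto simp: haar_def indicator_def A_def B_def power_divide)
  have "(\<Sum>v\<in>V. (haar j b v)\<^sup>2) = card A / (card A)\<^sup>2 + card B / (card B)\<^sup>2"
    using AB(2,3) finite_V
    by (simp add: sq sum.distrib sum_divide_distrib[symmetric] Int_absorb1 indicator_def sum.If_cases Int_def[symmetric] flip: Collect_mem_eq)
  then show ?thesis by (simp add: haar_norm_def A_def B_def power2_eq_square)
qed (auto simp: haar_def haar_norm_nonneg)

text \<open>The averaging kernel of the partition into blocks of level \<open>j\<close>.\<close>
definition kernel :: "nat \<Rightarrow> 'a \<Rightarrow> 'a \<Rightarrow> real" where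
  "kernel j u v = (if \<tau> u div 2 ^ j = \<tau> v div 2 ^ j then 1 / card (block j (\<tau> u div 2 ^ j)) else 0)"

text \<open>Splitting a block into halves refines averaging by exactly one dimension, spanned by the
  Haar function; the left side is the projection onto it. With an empty half the block is not
  refined, and both sides vanish.\<close>

lemma haar_product:
  assumes uv: "u \<in> V" "v \<in> V" and b: "b = \<tau> u div 2 ^ Suc j"
  shows "haar j b u * haar j b v / haar_norm j b = kernel j u v - kernel (Suc j) u v"
proof -
  define A B where "A = block j (2 * b)" and "B = block j (2 * b + 1)"
  have fin: "finite A" "finite B" by (auto simp: A_def B_def)
  have AB: "A \<inter> B = {}" using disjoint_blocks[of "2 * b" "2 * b + 1" j] by (auto simp: A_def B_def)
  have Suc_block: "block (Suc j) b = A \<union> B" by (simp add: A_def B_def block_Suc)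
  have uAB: "u \<in> A \<union> B" using uv b unfolding Suc_block[symmetric] by (simp add: block_def)
  have kS: "kernel (Suc j) u v = (if v \<in> A \<union> B then 1 / (real (card A) + real (card B)) else 0)"
    using uv b unfolding Suc_block[symmetric] kernel_def
    by (simp add: block_def[of "Suc j"]) (use card_Un_disjoint[OF fin AB] Suc_block in \<open>simp add: block_def\<close>)
  have kA: "kernel j u v = (if v \<in> A then 1 / real (card A) else 0)" if "u \<in> A"
    using that uv by (auto simp: kernel_def A_def block_def)
  have kB: "kernel j u v = (if v \<in> B then 1 / real (card B) else 0)" if "u \<in> B"
    using that uv by (auto simp: kernel_def B_def block_def)
  have r: "haar j b x = (if A = {} \<or> B = {} then 0 else indicator A x / card A - indicator B x / card B)" for x
    by (simp add: haar_def A_def B_def)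
  have rho: "haar_norm j b = 1 / card A + 1 / card B" by (simp add: haar_norm_def A_def B_def)
  show ?thesis
  proof (cases "A = {} \<or> B = {}")
    case True
    then show ?thesis using uAB by (auto simp: r kS kA kB)
  next
    case False
    then have pos: "real (card A) > 0" "real (card B) > 0" using fin by (auto simp: card_gt_0_iff)
    have same: "1 / a * (1 / a) / (1 / a + 1 / c) = 1 / a - 1 / (a + c)"
      and opposite: "1 / a * (1 / c) / (1 / a + 1 / c) = 1 / (a + c)" if "a > 0" "c > 0" for a c :: real
    proof -
      have "1 / a + 1 / c = (a + c) / (a * c)" "1 / a - 1 / (a + c) = c / (a * (a + c))"
        using that by (simp_all add: field_simps)
      then show "1 / a * (1 / a) / (1 / a + 1 / c) = 1 / a - 1 / (a + c)"
        "1 / a * (1 / c) / (1 / a + 1 / c) = 1 / (a + c)" using that by simp_all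
    qed
    consider "u \<in> A" "v \<in> A" | "u \<in> A" "v \<in> B" | "u \<in> B" "v \<in> A" | "u \<in> B" "v \<in> B" | "v \<notin> A \<union> B"
      using uAB by blast
    then show ?thesis
    proof cases
      case 1
      then have "u \<notin> B" "v \<notin> B" using AB by auto
      then show ?thesis using 1 False same[OF pos] by (simp add: r rho kS kA)
    next
      case 2
      then have "u \<notin> B" "v \<notin> A" using AB by auto
      then show ?thesis using 2 False opposite[OF pos] by (simp add: r rho kS kA)
    next
      case 3
      then have "u \<notin> A" "v \<notin> B" using AB by auto
      then show ?thesis using 3 False opposite[OF pos] by (simp add: r rho kS kB mult.commute)
    next
      case 4
      then have "u \<notin> A" "v \<notin> A" using AB by auto
      then show ?thesis using 4 False same[OF pos(2,1)] by (simp add: r rho kS kB add.commute)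
    next
      case 5
      then show ?thesis using uAB by (auto simp: r kS kA kB)
    qed
  qed
qed

text \<open>On each level only the block containing \<open>u\<close> contributes, and
  \<open>haar_product\<close> makes the sum over levels telescope. Blocks of level 0 are singletons
  because \<open>\<tau>\<close> is injective, and level \<open>J\<close> is a single block.\<close>

lemma haar_resolution:
  assumes uv: "u \<in> V" "v \<in> V" and bnd: "\<And>v. v \<in> V \<Longrightarrow> \<tau> v < M" and M: "M \<le> 2 ^ J"
  shows "(\<Sum>j<J. \<Sum>b<M. haar j b u * haar j b v / haar_norm j b)
    = (if u = v then 1 else 0) - 1 / card V"
proof -
  have "(\<Sum>b<M. haar j b u * haar j b v / haar_norm j b) = kernel j u v - kernel (Suc j) u v" for j
  proof -
    have "\<tau> u div 2 ^ Suc j < M" using bnd[OF uv(1)] div_le_dividend le_less_trans by blast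
    then have "(\<Sum>b<M. haar j b u * haar j b v / haar_norm j b) =
      (\<Sum>b\<in>{\<tau> u div 2 ^ Suc j}. haar j b u * haar j b v / haar_norm j b)"
      using haar_outside[OF uv(1), of j] by (intro sum.mono_neutral_right) auto
    then show ?thesis using haar_product[OF uv refl] by simp
  qed
  then have "(\<Sum>j<J. \<Sum>b<M. haar j b u * haar j b v / haar_norm j b) = kernel 0 u v - kernel J u v"
    using sum_lessThan_telescope'[of "\<lambda>j. kernel j u v" J] by simp
  moreover have "kernel 0 u v = (if u = v then 1 else 0)"
  proof -
    have "block 0 (\<tau> u) = {u}" using inj uv by (auto simp: block_def inj_on_eq_iff)
    then show ?thesis using inj uv by (auto simp: kernel_def inj_on_eq_iff)
  qed
  moreover have "kernel J u v = 1 / card V"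
  proof -
    have small: "\<tau> x div 2 ^ J = 0" if "x \<in> V" for x using bnd[OF that] M by simp
    then have "block J 0 = V" by (auto simp: block_def)
    then show ?thesis using small uv by (simp add: kernel_def)
  qed
  ultimately show ?thesis by simp
qed

text \<open>On each level \<open>v\<close> lies in the support of at most one Haar function, so a
  load is governed by only \<open>J\<close> coefficients per line.\<close>

lemma sum_abs_haar_le:
  assumes "v \<in> V"
  shows "(\<Sum>b<M. \<bar>haar j b v\<bar> / haar_norm j b) \<le> 1"
proof -
  have le1: "\<bar>haar j b v\<bar> / haar_norm j b \<le> 1" for b
    using abs_haar_le_norm[of j b v] haar_norm_nonneg[of j b]
    by (cases "haar_norm j b = 0") (auto simp: divide_le_eq_1)
  have "(\<Sum>b<M. \<bar>haar j b v\<bar> / haar_norm j b) =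
    (\<Sum>b\<in>{..<M} \<inter> {\<tau> v div 2 ^ Suc j}. \<bar>haar j b v\<bar> / haar_norm j b)"
    using haar_outside[OF assms, of j]
    by (intro sum.mono_neutral_right) (auto, metis mult.commute power_Suc2)
  also have "\<dots> \<le> (\<Sum>b\<in>{..<M} \<inter> {\<tau> v div 2 ^ Suc j}. 1)"
    by (intro sum_mono le1)
  also have "\<dots> \<le> 1" using card_mono[of "{\<tau> v div 2 ^ Suc j}"] by simp
  finally show ?thesis .
qed

text \<open>
  Blocks entirely on one side of \<open>s\<close> have vanishing partial sum.
\<close>
lemma sum_abs_prefix_haar_le:
  "(\<Sum>b<M. \<bar>\<Sum>v\<in>{v \<in> V. \<tau> v \<le> s}. haar j b v\<bar>) \<le> 1"
proof -
  define U where "U = {v \<in> V. \<tau> v \<le> s}"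
  have UV: "U \<subseteq> V" by (auto simp: U_def)
  have zero: "(\<Sum>v\<in>U. haar j b v) = 0" if b: "b \<noteq> s div 2 ^ Suc j" for b
  proof (cases "b < s div 2 ^ Suc j")
    case True
    have "haar j b v = 0" if "v \<in> V - U" for v
    proof (rule haar_outside)
      have "s div 2 ^ Suc j \<le> \<tau> v div 2 ^ Suc j" using that by (intro div_le_mono) (auto simp: U_def)
      then show "\<tau> v div 2 ^ Suc j \<noteq> b" using True by simp
    qed (use that in simp)
    then have "(\<Sum>v\<in>U. haar j b v) = (\<Sum>v\<in>V. haar j b v)"
      using UV finite_V by (intro sum.mono_neutral_left) auto
    then show ?thesis by (simp add: sum_haar)
  next
    case False
    have "haar j b v = 0" if "v \<in> U" for v
    proof (rule haar_outside)
      have "\<tau> v div 2 ^ Suc j \<le> s div 2 ^ Suc j" using that by (intro div_le_mono) (auto simp: U_def)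
      then show "\<tau> v div 2 ^ Suc j \<noteq> b" using False b by simp
    qed (use that UV in auto)
    then show ?thesis by simp
  qed
  have one: "\<bar>\<Sum>v\<in>U. haar j b v\<bar> \<le> 1" for b
  proof (cases "block j (2 * b) = {} \<or> block j (2 * b + 1) = {}")
    case False
    have "real (card (U \<inter> block j c)) / card (block j c) \<le> 1" for c
      using card_mono[of "block j c" "U \<inter> block j c"] by (auto simp: divide_le_eq_1 card_gt_0_iff)
    moreover have "real (card (U \<inter> block j c)) / card (block j c) \<ge> 0" for c by simp
    ultimately show ?thesis using sum_haar_subset[OF UV] False by (smt (verit))
  qed (simp add: haar_def)
  have "(\<Sum>b<M. \<bar>\<Sum>v\<in>U. haar j b v\<bar>) = (\<Sum>b\<in>{..<M} \<inter> {s div 2 ^ Suc j}. \<bar>\<Sum>v\<in>U. haar j b v\<bar>)"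
    using zero by (intro sum.mono_neutral_right) auto
  also have "\<dots> \<le> (\<Sum>b\<in>{..<M} \<inter> {s div 2 ^ Suc j}. 1)" by (intro sum_mono one)
  also have "\<dots> \<le> 1" using card_mono[of "{s div 2 ^ Suc j}"] by simp
  finally show ?thesis by (simp add: U_def)
qed

end

section \<open>Flows along a walk\<close>

text \<open>A walk revisits vertices; numbering each by its first visit makes the numbering
  injective and assigns its supply to a single position.\<close>

definition first_index :: "'a list \<Rightarrow> 'a \<Rightarrow> nat" where
  "first_index W v = length (takeWhile (\<lambda>x. x \<noteq> v) W)"

lemma first_index_less: "v \<in> set W \<Longrightarrow> first_index W v < length W"
  unfolding first_index_def by (induction W) auto

lemma nth_first_index: "v \<in> set W \<Longrightarrow> W ! first_index W v = v"
  using nth_length_takeWhile[of "\<lambda>x. x \<noteq> v" W] first_index_less[of v W] by (simp add: first_index_def)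

lemma first_index_nth_le: "j < length W \<Longrightarrow> first_index W (W ! j) \<le> j"
  unfolding first_index_def
  by (metis (mono_tags) leI nth_mem nth_take set_takeWhileD takeWhile_eq_take takeWhile_nth)

lemma inj_first_index: "inj_on (first_index W) (set W)"
  by (metis inj_onI nth_first_index)

definition prefix_sum :: "'a list \<Rightarrow> ('a \<Rightarrow> real) \<Rightarrow> nat \<Rightarrow> real" where
  "prefix_sum W r j = (\<Sum>v\<in>{v \<in> set W. first_index W v \<le> j}. r v)"

text \<open>
  Routing the supply \<open>r\<close> along the walk sends \<open>prefix_sum W r j\<close> from the \<open>j\<close>-th to the next
  vertex; \<open>walk_flow W r e w\<close> is the resulting net inflow into \<open>w\<close> through \<open>e\<close>.
\<close>
definition walk_flow :: "'a list \<Rightarrow> ('a \<Rightarrow> real) \<Rightarrow> 'a set \<Rightarrow> 'a \<Rightarrow> real" where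
  "walk_flow W r e w = (\<Sum>j<length W - 1. if walk_edges W ! j = e
     then prefix_sum W r j * (of_bool (W ! Suc j = w) - of_bool (W ! j = w)) else 0)"

text \<open>A traversal of \<open>e\<close> takes from one endpoint what it gives to the other. This
  lets the biases of the two endpoints add up to 1.\<close>

lemma sum_walk_flow_edge:
  assumes "finite e"
  shows "(\<Sum>w\<in>e. walk_flow W r e w) = 0"
proof -
  have "(\<Sum>w\<in>e. if walk_edges W ! j = e
     then prefix_sum W r j * (of_bool (W ! Suc j = w) - of_bool (W ! j = w)) else 0) = 0"
    if "j < length W - 1" for j
  proof (cases "walk_edges W ! j = e")
    case True
    then have "W ! Suc j \<in> e" "W ! j \<in> e" using walk_edges_nth[of j W] that by auto
    then show ?thesis using True assms
      by (simp add: of_bool_def sum_subtractf flip: sum_distrib_left)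
  qed simp
  then show ?thesis unfolding walk_flow_def by (subst sum.swap) simp
qed

lemma walk_flow_outside:
  assumes "w \<notin> e" shows "walk_flow W r e w = 0"
proof -
  have "\<not> (walk_edges W ! j = e \<and> (W ! Suc j = w \<or> W ! j = w))" if "j < length W - 1" for j
    using walk_edges_nth[of j W] that assms by auto
  then show ?thesis unfolding walk_flow_def by (intro sum.neutral) auto
qed

lemma prefix_sum_diff:
  assumes "Suc l < length W"
  shows "prefix_sum W r (Suc l) - prefix_sum W r l =
    (if first_index W (W ! Suc l) = Suc l then r (W ! Suc l) else 0)"
proof -
  have split: "{v \<in> set W. first_index W v \<le> Suc l} =
     {v \<in> set W. first_index W v \<le> l} \<union> {v \<in> set W. first_index W v = Suc l}" by auto
  have "prefix_sum W r (Suc l) = prefix_sum W r l + (\<Sum>v\<in>{v \<in> set W. first_index W v = Suc l}. r v)"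
    unfolding prefix_sum_def split by (intro sum.union_disjoint) auto
  also have "{v \<in> set W. first_index W v = Suc l} =
     (if first_index W (W ! Suc l) = Suc l then {W ! Suc l} else {})"
    using assms nth_first_index[of _ W] by auto metis+
  finally show ?thesis by simp
qed

text \<open>Conservation along the walk: after \<open>l\<close> steps the supply of every vertex met
  so far has been picked up, and all of it is carried at the current vertex
  \<open>W ! l\<close>.\<close>

lemma walk_flow_partial:
  assumes "l < length W" "w \<in> set W"
  shows "(\<Sum>j<l. prefix_sum W r j * (of_bool (W ! Suc j = w) - of_bool (W ! j = w))) =
    prefix_sum W r l * of_bool (W ! l = w) - (if first_index W w \<le> l then r w else 0)"
  using assms(1)
proof (induction l)
  case 0
  have "{v \<in> set W. first_index W v = 0} = {W ! 0}"
    using 0 nth_first_index[of _ W] first_index_nth_le[of 0 W] by auto metis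
  moreover have "first_index W w = 0 \<longleftrightarrow> W ! 0 = w"
    using calculation assms(2) by (metis (mono_tags, lifting) mem_Collect_eq singleton_iff)
  ultimately show ?case by (auto simp: prefix_sum_def)
next
  case (Suc l)
  have "W ! Suc l = w" if "first_index W w = Suc l" using nth_first_index[OF assms(2)] that by simp
  then have "(prefix_sum W r (Suc l) - prefix_sum W r l) * of_bool (W ! Suc l = w) =
     (if first_index W w = Suc l then r w else 0)"
    unfolding prefix_sum_diff[OF Suc.prems] by auto
  then show ?case using Suc by (auto simp: algebra_simps le_Suc_eq)
qed

text \<open>At the end of the walk every vertex has been met and the carried amount is the total
  supply, which is 0; what remains is that each vertex has given away \<open>r w\<close>.\<close>

lemma sum_walk_flow_vertex:
  assumes "finite E" "set (walk_edges W) \<subseteq> E" and w: "w \<in> set W" and r: "(\<Sum>v\<in>set W. r v) = 0"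
  shows "(\<Sum>e\<in>{e \<in> E. w \<in> e}. walk_flow W r e w) = - r w"
proof -
  have len: "length W - 1 < length W" using w by (cases W) auto
  have "(\<Sum>e\<in>{e \<in> E. w \<in> e}. walk_flow W r e w) = (\<Sum>e\<in>E. walk_flow W r e w)"
    using assms(1) by (intro sum.mono_neutral_left) (auto simp: walk_flow_outside)
  also have "\<dots> = (\<Sum>j<length W - 1. prefix_sum W r j * (of_bool (W ! Suc j = w) - of_bool (W ! j = w)))"
  proof -
    have "walk_edges W ! j \<in> E" if "j < length W - 1" for j
      using assms(2) that by (metis length_walk_edges nth_mem subsetD)
    then show ?thesis unfolding walk_flow_def using assms(1) by (subst sum.swap) simp
  qed
  also have "\<dots> = - r w"
  proof -
    have le: "first_index W v \<le> length W - 1" if "v \<in> set W" for v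
      using first_index_less[OF that] by simp
    then have "{v \<in> set W. first_index W v \<le> length W - 1} = set W" by blast
    then have "prefix_sum W r (length W - 1) = 0" using r by (simp add: prefix_sum_def)
    then show ?thesis unfolding walk_flow_partial[OF len w] using le[OF w] by simp
  qed
  finally show ?thesis .
qed

text \<open>Bounding the whole family at each position, rather than each flow separately, exploits
  that on one level at most one Haar function has a nonzero prefix sum there.\<close>

lemma sum_abs_walk_flow_le:
  assumes "finite I" and "\<And>j. j < length W \<Longrightarrow> (\<Sum>i\<in>I. \<bar>prefix_sum W (r i) j\<bar>) \<le> c"
  shows "(\<Sum>i\<in>I. \<bar>walk_flow W (r i) e w\<bar>) \<le> c * count_list (walk_edges W) e"
proof -
  have "\<bar>walk_flow W (r i) e w\<bar> \<le> (\<Sum>j<length W - 1. if walk_edges W ! j = e then \<bar>prefix_sum W (r i) j\<bar> else 0)" for i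
    unfolding walk_flow_def by (rule order_trans[OF sum_abs sum_mono]) (auto simp: abs_mult)
  then have "(\<Sum>i\<in>I. \<bar>walk_flow W (r i) e w\<bar>)
     \<le> (\<Sum>i\<in>I. \<Sum>j<length W - 1. if walk_edges W ! j = e then \<bar>prefix_sum W (r i) j\<bar> else 0)"
    by (rule sum_mono)
  also have "\<dots> = (\<Sum>j<length W - 1. if walk_edges W ! j = e then \<Sum>i\<in>I. \<bar>prefix_sum W (r i) j\<bar> else 0)"
    by (subst sum.swap) (intro sum.cong, auto)
  also have "\<dots> \<le> (\<Sum>j<length W - 1. if walk_edges W ! j = e then c else 0)"
    by (intro sum_mono) (auto intro!: assms(2))
  also have "\<dots> = c * card {j. j < length W - 1 \<and> walk_edges W ! j = e}"
    by (simp add: sum.If_cases Int_def mult.commute)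
  also have "card {j. j < length W - 1 \<and> walk_edges W ! j = e} = count_list (walk_edges W) e"
    by (simp add: count_list_eq_length_filter length_filter_conv_card eq_commute)
  finally show ?thesis .
qed

section \<open>Exponential potential\<close>

lemma exp_le_quadratic:
  fixes y :: real assumes "\<bar>y\<bar> \<le> 1" shows "exp y \<le> 1 + y + y\<^sup>2"
proof (cases "y \<ge> 0")
  case True
  then show ?thesis using exp_bound[of y] assms by (simp add: power2_eq_square)
next
  case False
  define x where "x = - y"
  have x: "0 \<le> x" "x \<le> 1" using False assms by (auto simp: x_def)
  \<comment> \<open>Multiplying by \<open>exp x\<close> with \<open>x = - y\<close> and using
    \<open>exp x \<ge> 1 + x\<close> reduces the claim to \<open>1 + x ^ 3 \<ge> 1\<close>.\<close>
  have "(1 + y + y\<^sup>2) * exp x \<ge> (1 - x + x\<^sup>2) * (1 + x)"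
  proof -
    have "1 - x + x\<^sup>2 \<ge> 0" using x by (simp add: add_nonneg_nonneg)
    then have "(1 - x + x\<^sup>2) * (1 + x) \<le> (1 - x + x\<^sup>2) * exp x"
      using exp_ge_add_one_self by (intro mult_left_mono) auto
    then show ?thesis by (simp add: x_def)
  qed
  moreover have "(1 - x + x\<^sup>2) * (1 + x) = 1 + x ^ 3" by (simp add: algebra_simps power2_eq_square power3_eq_cube)
  moreover have "x ^ 3 \<ge> 0" using x by simp
  ultimately have "1 \<le> (1 + y + y\<^sup>2) * exp x" by linarith
  then have "exp y \<le> (1 + y + y\<^sup>2) * exp x * exp y" by (simp add: mult_le_cancel_right1)
  also have "\<dots> = 1 + y + y\<^sup>2" by (simp add: x_def mult.assoc flip: exp_add)
  finally show ?thesis .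
qed

lemma expectation_exp_le:
  fixes X :: "'b \<Rightarrow> real"
  assumes fin: "finite (set_pmf M)" and mean: "measure_pmf.expectation M X = 0"
    and second: "measure_pmf.expectation M (\<lambda>x. (X x)\<^sup>2) \<le> s"
    and bound: "\<And>x. x \<in> set_pmf M \<Longrightarrow> \<bar>c * X x\<bar> \<le> 1"
  shows "measure_pmf.expectation M (\<lambda>x. exp (c * X x)) \<le> exp (c\<^sup>2 * s)"
proof -
  have int: "integrable (measure_pmf M) f" for f :: "'b \<Rightarrow> real"
    by (rule integrable_measure_pmf_finite[OF fin])
  have "measure_pmf.expectation M (\<lambda>x. exp (c * X x))
      \<le> measure_pmf.expectation M (\<lambda>x. 1 + c * X x + c\<^sup>2 * (X x)\<^sup>2)"
    using exp_le_quadratic[OF bound]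
    by (intro integral_mono_AE int) (auto simp: AE_measure_pmf_iff power_mult_distrib)
  also have "\<dots> = 1 + c * measure_pmf.expectation M X + c\<^sup>2 * measure_pmf.expectation M (\<lambda>x. (X x)\<^sup>2)"
    using int by simp
  also have "\<dots> \<le> 1 + c\<^sup>2 * s" using second mean by (simp add: mult_left_mono)
  also have "\<dots> \<le> exp (c\<^sup>2 * s)" by (rule exp_ge_add_one_self)
  finally show ?thesis .
qed

section \<open>The potential \<open>2 * cosh (a * z)\<close> under noise and drift\<close>

definition potential :: "real \<Rightarrow> real \<Rightarrow> real" where
  "potential a z = exp (a * z) + exp (- a * z)"

text \<open>The value at 0 is 1, so the drift has full size everywhere; near the origin the additive
  term of the potential bound pays for overshooting.\<close>

definition sign :: "real \<Rightarrow> real" where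
  "sign z = (if z \<ge> 0 then 1 else - 1)"

lemma abs_sign [simp]: "\<bar>sign z\<bar> = 1"
  by (simp add: sign_def)

text \<open>Here \<open>u\<close> stands for \<open>exp (a * \<bar>z\<bar>)\<close>. Drift and noise
  together shrink the large exponential by \<open>exp (- \<theta>)\<close>. The small one may grow
  by \<open>exp (3 * \<theta>)\<close>, but as \<open>1 / u \<le> 1\<close> this adds only
  \<open>O(\<theta>)\<close>.\<close>

lemma contraction_bound:
  fixes u \<theta> :: real
  assumes \<theta>: "0 \<le> \<theta>" "\<theta> \<le> 1" and u: "u \<ge> 1"
  shows "u * exp (- \<theta>) + exp (3 * \<theta>) / u \<le> (1 - \<theta> / 2) * (u + 1 / u) + 82 * \<theta>"
proof -
  have "exp (- \<theta>) = 1 / exp \<theta>" by (simp add: exp_minus field_simps)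
  also have "\<dots> \<le> 1 / (1 + \<theta>)"
    using \<theta> exp_ge_add_one_self[of \<theta>] by (intro divide_left_mono) auto
  also have "\<dots> \<le> 1 - \<theta> / 2"
  proof -
    have "\<theta> * \<theta> \<le> \<theta>" using \<theta> by (simp add: mult_left_le)
    then show ?thesis using \<theta> by (subst pos_divide_le_eq) (auto simp: algebra_simps)
  qed
  finally have 1: "u * exp (- \<theta>) \<le> u * (1 - \<theta> / 2)" using u by (intro mult_left_mono) auto
  \<comment> \<open>From \<open>exp x * (1 - x) \<le> 1\<close> follows
    \<open>exp x \<le> 1 + x * exp x\<close>; with \<open>exp 3 \<le> 27\<close> this gives the
    constant 81, and the further \<open>\<theta> / 2\<close> is rounded up to 82.\<close>
  have "exp (3 * \<theta>) * (1 - 3 * \<theta>) \<le> exp (3 * \<theta>) * exp (- (3 * \<theta>))"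
    using exp_ge_add_one_self[of "- (3 * \<theta>)"] by (intro mult_left_mono) auto
  then have "exp (3 * \<theta>) \<le> 1 + 3 * \<theta> * exp (3 * \<theta>)"
    by (simp add: algebra_simps flip: exp_add)
  also have "exp (3 * \<theta>) \<le> exp (1 + 1 + 1)" using \<theta> by simp
  also have "exp (1 + 1 + 1 :: real) \<le> 3 * 3 * 3"
    unfolding exp_add by (intro mult_mono exp_le) auto
  finally have "exp (3 * \<theta>) \<le> 1 + 81 * \<theta>" using \<theta> by (simp add: mult_left_mono)
  then have "exp (3 * \<theta>) / u \<le> (1 + 81 * \<theta>) / u" using u by (intro divide_right_mono) auto
  also have "\<dots> = (1 - \<theta> / 2) / u + 81 * \<theta> / u + \<theta> / 2 / u" using u by (simp add: field_simps)
  also have "\<dots> \<le> (1 - \<theta> / 2) / u + 81 * \<theta> / 1 + \<theta> / 2 / 1"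
    using u \<theta> by (intro add_mono divide_left_mono) auto
  finally have "exp (3 * \<theta>) / u \<le> (1 - \<theta> / 2) / u + 82 * \<theta>" using \<theta> by simp
  moreover have "(1 - \<theta> / 2) * (u + 1 / u) = u * (1 - \<theta> / 2) + (1 - \<theta> / 2) / u"
    by (simp only: distrib_left times_divide_eq_right mult_1_right mult.commute[of u])
  ultimately show ?thesis using 1 by linarith
qed

text \<open>
  A drift of \<open>2\<theta>/a\<close> towards the origin outweighs noise of variance at most \<open>\<theta>/a\<^sup>2\<close>.
\<close>
lemma expectation_potential_le:
  fixes X :: "'b \<Rightarrow> real"
  assumes fin: "finite (set_pmf M)" and mean: "measure_pmf.expectation M X = 0"
    and second: "a\<^sup>2 * measure_pmf.expectation M (\<lambda>x. (X x)\<^sup>2) \<le> \<theta>"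
    and bound: "\<And>x. x \<in> set_pmf M \<Longrightarrow> \<bar>a * X x\<bar> \<le> 1"
    and \<theta>: "0 \<le> \<theta>" "\<theta> \<le> 1" and drift: "a * \<kappa> = 2 * \<theta>" and a: "a > 0"
  shows "measure_pmf.expectation M (\<lambda>x. potential a (z + X x - sign z * \<kappa>))
    \<le> (1 - \<theta> / 2) * potential a z + 82 * \<theta>"
proof -
  have int: "integrable (measure_pmf M) f" for f :: "'b \<Rightarrow> real"
    by (rule integrable_measure_pmf_finite[OF fin])
  \<comment> \<open>The potential is even, so reflecting by \<open>\<epsilon>\<close> reduces both
    signs of \<open>z\<close> to the case of \<open>\<bar>z\<bar>\<close> with the drift pointing
    down.\<close>
  define \<epsilon> where "\<epsilon> = sign z"
  have \<epsilon>: "\<epsilon> * \<epsilon> = 1" "\<epsilon> * z = \<bar>z\<bar>" "\<epsilon> = 1 \<or> \<epsilon> = - 1" by (auto simp: \<epsilon>_def sign_def)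
  have sym: "potential a y = exp (a * (\<epsilon> * y)) + exp (- a * (\<epsilon> * y))" for y
    using \<epsilon>(3) by (auto simp: potential_def)
  have mgf: "measure_pmf.expectation M (\<lambda>x. exp (c * X x)) \<le> exp \<theta>" if "c = a \<or> c = - a" for c
  proof -
    have "measure_pmf.expectation M (\<lambda>x. exp (c * X x)) \<le> exp (c\<^sup>2 * measure_pmf.expectation M (\<lambda>x. (X x)\<^sup>2))"
      using that bound by (intro expectation_exp_le fin mean) auto
    also have "\<dots> \<le> exp \<theta>" using second that by auto
    finally show ?thesis .
  qed
  have "potential a (z + X x - sign z * \<kappa>) =
     exp (a * \<bar>z\<bar>) * exp (- 2 * \<theta>) * exp ((a * \<epsilon>) * X x) + exp (- a * \<bar>z\<bar>) * exp (2 * \<theta>) * exp (- (a * \<epsilon>) * X x)" for x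
  proof -
    define y where "y = z + X x - sign z * \<kappa>"
    have y: "a * (\<epsilon> * y) = a * \<bar>z\<bar> + - 2 * \<theta> + (a * \<epsilon>) * X x"
      using \<epsilon> drift unfolding y_def \<epsilon>_def[symmetric] by (auto simp: algebra_simps)
    have "potential a y = exp (a * (\<epsilon> * y)) + exp (- (a * (\<epsilon> * y)))" by (simp add: sym)
    then show ?thesis unfolding y unfolding y_def[symmetric] exp_add[symmetric] by simp
  qed
  then have "measure_pmf.expectation M (\<lambda>x. potential a (z + X x - sign z * \<kappa>)) =
     exp (a * \<bar>z\<bar>) * exp (- 2 * \<theta>) * measure_pmf.expectation M (\<lambda>x. exp ((a * \<epsilon>) * X x))
     + exp (- a * \<bar>z\<bar>) * exp (2 * \<theta>) * measure_pmf.expectation M (\<lambda>x. exp (- (a * \<epsilon>) * X x))"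
    using int by simp
  also have "\<dots> \<le> exp (a * \<bar>z\<bar>) * exp (- 2 * \<theta>) * exp \<theta> + exp (- a * \<bar>z\<bar>) * exp (2 * \<theta>) * exp \<theta>"
    using \<epsilon>(3) by (intro add_mono mult_left_mono mgf) auto
  also have "\<dots> = exp (a * \<bar>z\<bar>) * exp (- \<theta>) + exp (3 * \<theta>) / exp (a * \<bar>z\<bar>)"
    by (simp add: field_simps exp_minus flip: exp_add)
  also have "\<dots> \<le> (1 - \<theta> / 2) * (exp (a * \<bar>z\<bar>) + 1 / exp (a * \<bar>z\<bar>)) + 82 * \<theta>"
    using \<theta> a by (intro contraction_bound) auto
  also have "exp (a * \<bar>z\<bar>) + 1 / exp (a * \<bar>z\<bar>) = potential a z"
    unfolding sym \<epsilon>(2) by (simp add: exp_minus inverse_eq_divide)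
  finally show ?thesis .
qed

lemma potential_ge: "a > 0 \<Longrightarrow> \<bar>z\<bar> > s \<Longrightarrow> potential a z \<ge> exp (a * s)"
proof (cases "z \<ge> 0")
  case True
  assume "a > 0" "\<bar>z\<bar> > s"
  then have "exp (a * s) \<le> exp (a * z)" using True by simp
  then show ?thesis unfolding potential_def using exp_ge_zero[of "- a * z"] by linarith
next
  case False
  assume *: "a > 0" "\<bar>z\<bar> > s"
  then have "a * s \<le> a * (- z)" using False by (intro mult_left_mono) auto
  then have "exp (a * s) \<le> exp (- a * z)" by simp
  then show ?thesis unfolding potential_def using exp_ge_zero[of "a * z"] by linarith
qed

section \<open>The balancing strategy\<close>

text \<open>\<open>P\<close> indexes the Haar functions \<open>r p\<close> of all \<open>N\<close>
  lines, \<open>\<rho> p\<close> bounds their squared norms, and \<open>G p\<close> is a flow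
  draining \<open>r p\<close>. \<open>Q\<close> is the capacity that all flows together need on an
  edge, and \<open>\<Lambda>\<close> bounds the coefficients entering a load, averaged over the
  lines. By \<open>resolution\<close> the functions represent the projection off the constants
  \<open>N\<close> times.\<close>

locale balancing_frame =
  fixes V :: "'a set" and E :: "'a set set" and d :: nat
    and P :: "'p set" and r :: "'p \<Rightarrow> 'a \<Rightarrow> real" and \<rho> :: "'p \<Rightarrow> real"
    and G :: "'p \<Rightarrow> 'a set \<Rightarrow> 'a \<Rightarrow> real" and Q N \<Lambda> :: real
  assumes simple: "simple_graph V E" and V_ne: "V \<noteq> {}"
    and regular: "regular_graph V E d" and d_pos: "d > 0"
    and finite_P: "finite P" and Q_pos: "Q > 0" and N_pos: "N > 0"
    and sum_r: "\<And>p. p \<in> P \<Longrightarrow> (\<Sum>v\<in>V. r p v) = 0"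
    and abs_r: "\<And>p v. p \<in> P \<Longrightarrow> \<bar>r p v\<bar> \<le> 1"
    and sum_r_square: "\<And>p. p \<in> P \<Longrightarrow> (\<Sum>v\<in>V. (r p v)\<^sup>2) \<le> \<rho> p"
    and \<rho>_le: "\<And>p. p \<in> P \<Longrightarrow> \<rho> p \<le> 2"
    and sum_abs_r: "\<And>v. v \<in> V \<Longrightarrow> (\<Sum>p\<in>P. \<bar>r p v\<bar> / \<rho> p) \<le> N * \<Lambda>"
    and resolution: "\<And>u v. u \<in> V \<Longrightarrow> v \<in> V \<Longrightarrow>
      (\<Sum>p\<in>P. r p u * r p v / \<rho> p) = N * (of_bool (u = v) - 1 / card V)"
    and G_edge: "\<And>p e. p \<in> P \<Longrightarrow> e \<in> E \<Longrightarrow> (\<Sum>w\<in>e. G p e w) = 0"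
    and G_vertex: "\<And>p w. p \<in> P \<Longrightarrow> w \<in> V \<Longrightarrow> (\<Sum>e\<in>{e \<in> E. w \<in> e}. G p e w) = - r p w"
    and G_bound: "\<And>e w. e \<in> E \<Longrightarrow> w \<in> e \<Longrightarrow> (\<Sum>p\<in>P. \<bar>G p e w\<bar>) \<le> Q"
begin

abbreviation "n \<equiv> card V"
abbreviation "m \<equiv> card E"

text \<open>Chosen so that the drifts \<open>\<beta> * \<rho> p\<close> of all coefficients
  recombine to the expected change of the loads caused by the flows. The factor \<open>N\<close>
  appears because loads are averages over \<open>N\<close> lines.\<close>

definition \<beta> :: real where "\<beta> = N / (2 * Q * m)"

definition bias :: "('p \<Rightarrow> real) \<Rightarrow> 'a set \<Rightarrow> 'a \<Rightarrow> real" where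
  "bias z e w = 1 / 2 + (\<Sum>p\<in>P. sign (z p) * G p e w) / (2 * Q)"

definition landing :: "('p \<Rightarrow> real) \<Rightarrow> 'a \<Rightarrow> real" where
  "landing z w = 1 / n - (\<Sum>p\<in>P. sign (z p) * r p w) / (2 * Q * m)"

definition mean :: "('p \<Rightarrow> real) \<Rightarrow> 'p \<Rightarrow> real" where
  "mean z p = (\<Sum>u\<in>V. landing z u * r p u)"

text \<open>A coordinate \<open>z p\<close> is not the inner product of \<open>r p\<close> with the
  loads: the \<open>N\<close> Haar systems are redundant, so the loads have many representations.
  Each coordinate receives the centred noise of its own line, but the mean, which mixes the flows of
  all lines, is replaced by the drift of its own flow. \<open>load_deviation\<close> shows that
  these replacements cancel in the loads.\<close>

definition step :: "('p \<Rightarrow> real) \<Rightarrow> 'a \<Rightarrow> 'p \<Rightarrow> real" where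
  "step z v p = z p + (r p v - mean z p) - sign (z p) * (\<beta> * \<rho> p)"

definition state :: "'a history \<Rightarrow> 'p \<Rightarrow> real" where
  "state h = foldl (\<lambda>z x. step z (snd x)) (\<lambda>_. 0) h"

definition strategy :: "'a strategy" where
  "strategy h e = (if e \<in> E then embed_pmf (\<lambda>w. if w \<in> e then bias (state h) e w else 0)
     else return_pmf undefined)"

definition vertex_law :: "'a history \<Rightarrow> 'a pmf" where
  "vertex_law h = bind_pmf (pmf_of_set E) (strategy h)"

section \<open>The law of the next ball\<close>

lemma finite_V: "finite V" and finite_E: "finite E"
  using simple simple_graph_finite_edges by (auto simp: simple_graph_def)

lemma edge: "e \<in> E \<Longrightarrow> e \<subseteq> V" "e \<in> E \<Longrightarrow> card e = 2" "e \<in> E \<Longrightarrow> finite e"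
  using simple by (auto simp: simple_graph_def intro: card_ge_0_finite)

lemma handshake: "2 * m = d * n"
proof -
  have "(\<Sum>v\<in>V. card {e \<in> E. v \<in> e}) = 2 * m"
  proof (rule sum_multicount)
    have "{v \<in> V. v \<in> e} = e" if "e \<in> E" for e using edge(1)[OF that] by auto
    then show "\<forall>e\<in>E. card {v \<in> V. v \<in> e} = 2" using edge(2) by simp
  qed (auto simp: finite_V finite_E)
  moreover have "(\<Sum>v\<in>V. card {e \<in> E. v \<in> e}) = n * d"
    using regular by (simp add: regular_graph_def)
  ultimately show ?thesis by (simp add: mult.commute)
qed

lemma n_pos: "n > 0" and m_pos: "m > 0"
proof -
  show "n > 0" using finite_V V_ne by (simp add: card_gt_0_iff)
  then have "d * n > 0" using d_pos by simp
  then show "m > 0" using handshake by linarith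
qed

lemma E_ne: "E \<noteq> {}"
  using m_pos by auto

lemma \<rho>_nonneg: "p \<in> P \<Longrightarrow> \<rho> p \<ge> 0"
  using order_trans[OF sum_nonneg sum_r_square] by fastforce

text \<open>Makes the cancellation of \<open>\<rho> p\<close> valid also where division by it yields
  the default value 0.\<close>

lemma \<rho>_eq_0: "p \<in> P \<Longrightarrow> \<rho> p = 0 \<Longrightarrow> v \<in> V \<Longrightarrow> r p v = 0"
  using sum_r_square[of p] member_le_sum[of v V "\<lambda>v. (r p v)\<^sup>2"] finite_V
  by (metis order_trans power2_less_eq_zero_iff zero_le_power2)

text \<open>\<open>Q\<close> bounds the flows through an edge whatever their signs. The bias is thus
  a probability in every state, as required of a strategy on arbitrary histories.\<close>

lemma bias_bounds:
  assumes "e \<in> E" "w \<in> e"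
  shows "0 \<le> bias z e w" "bias z e w \<le> 1"
proof -
  have "\<bar>\<Sum>p\<in>P. sign (z p) * G p e w\<bar> \<le> (\<Sum>p\<in>P. \<bar>sign (z p) * G p e w\<bar>)" by (rule sum_abs)
  also have "\<dots> \<le> Q" using G_bound[OF assms] by (simp add: abs_mult)
  finally have "\<bar>(\<Sum>p\<in>P. sign (z p) * G p e w) / (2 * Q)\<bar> \<le> 1 / 2" using Q_pos by (simp add: field_simps)
  then show "0 \<le> bias z e w" "bias z e w \<le> 1" unfolding bias_def by linarith+
qed

lemma sum_bias: "e \<in> E \<Longrightarrow> (\<Sum>w\<in>e. bias z e w) = 1"
proof -
  assume e: "e \<in> E"
  have "(\<Sum>w\<in>e. \<Sum>p\<in>P. sign (z p) * G p e w) = 0"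
    using G_edge[OF _ e] by (subst sum.swap) (simp flip: sum_distrib_left)
  then show ?thesis
    using edge[OF e] by (simp add: bias_def sum.distrib flip: sum_divide_distrib)
qed

lemma pmf_strategy:
  assumes e: "e \<in> E"
  shows "pmf (strategy h e) w = (if w \<in> e then bias (state h) e w else 0)"
proof -
  have "(\<integral>\<^sup>+ w. ennreal (if w \<in> e then bias (state h) e w else 0) \<partial>count_space UNIV)
     = (\<Sum>w\<in>e. ennreal (bias (state h) e w))"
    using edge(3)[OF e] by (subst nn_integral_count_space'[of e]) auto
  also have "\<dots> = ennreal (\<Sum>w\<in>e. bias (state h) e w)"
    using bias_bounds[OF e] by (intro sum_ennreal) auto
  finally have "(\<integral>\<^sup>+ w. ennreal (if w \<in> e then bias (state h) e w else 0) \<partial>count_space UNIV) = 1"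
    by (simp add: sum_bias[OF e])
  then show ?thesis
    using e bias_bounds[OF e] by (simp add: strategy_def pmf_embed_pmf)
qed

lemma set_strategy: "e \<in> E \<Longrightarrow> set_pmf (strategy h e) \<subseteq> e"
  by (auto simp: set_pmf_iff pmf_strategy split: if_splits)

lemma allocation_strategy: "allocation_strategy E strategy"
  using set_strategy by (auto simp: allocation_strategy_def)

lemma set_vertex_law: "set_pmf (vertex_law h) \<subseteq> V"
  using set_strategy edge(1) unfolding vertex_law_def set_bind_pmf set_pmf_of_set[OF E_ne finite_E] by blast

lemma finite_vertex_law: "finite (set_pmf (vertex_law h))"
  using set_vertex_law finite_V finite_subset by blast

lemma pmf_vertex_law_sum: "pmf (vertex_law h) w = (\<Sum>e\<in>{e \<in> E. w \<in> e}. bias (state h) e w) / m"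
proof -
  have "pmf (vertex_law h) w = (\<Sum>e\<in>E. pmf (strategy h e) w) / m"
    using E_ne finite_E by (simp add: vertex_law_def pmf_bind integral_pmf_of_set)
  also have "(\<Sum>e\<in>E. pmf (strategy h e) w) = (\<Sum>e\<in>{e \<in> E. w \<in> e}. bias (state h) e w)"
    using finite_E by (simp add: pmf_strategy sum.If_cases Int_def)
  finally show ?thesis .
qed

lemma degree: "w \<in> V \<Longrightarrow> card {e \<in> E. w \<in> e} = d"
  using regular by (simp add: regular_graph_def)

text \<open>By regularity the fair halves add up to \<open>d / 2\<close> at every vertex, giving the
  uniform law by \<open>handshake\<close>; the flows add up to their divergence.\<close>

lemma pmf_vertex_law:
  assumes w: "w \<in> V"
  shows "pmf (vertex_law h) w = landing (state h) w"
proof -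
  have "(\<Sum>e\<in>{e \<in> E. w \<in> e}. \<Sum>p\<in>P. sign (state h p) * G p e w) = - (\<Sum>p\<in>P. sign (state h p) * r p w)"
    using G_vertex[OF _ w] by (subst sum.swap) (simp add: sum_negf flip: sum_distrib_left)
  then have "(\<Sum>e\<in>{e \<in> E. w \<in> e}. bias (state h) e w)
      = d / 2 - (\<Sum>p\<in>P. sign (state h p) * r p w) / (2 * Q)"
    by (simp add: bias_def sum.distrib degree[OF w] flip: sum_divide_distrib)
  moreover have "real d / 2 / m = 1 / n"
    using arg_cong[OF handshake, of real] n_pos m_pos d_pos by (simp add: field_simps)
  ultimately show ?thesis
    by (simp add: pmf_vertex_law_sum landing_def diff_divide_distrib)
qed

text \<open>Even with full bias a vertex is hit only if an incident edge is requested. This keeps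
  the variance of \<open>r p\<close> of order \<open>\<rho> p / n\<close>.\<close>

lemma pmf_vertex_law_le:
  assumes w: "w \<in> V"
  shows "pmf (vertex_law h) w \<le> 2 / n"
proof -
  have "(\<Sum>e\<in>{e \<in> E. w \<in> e}. bias (state h) e w) \<le> (\<Sum>e\<in>{e \<in> E. w \<in> e}. 1)"
    by (intro sum_mono bias_bounds) auto
  then have "pmf (vertex_law h) w \<le> d / m"
    by (simp add: pmf_vertex_law_sum degree[OF w] divide_right_mono)
  also have "real d / m = 2 / n"
    using arg_cong[OF handshake, of real] n_pos m_pos d_pos by (simp add: field_simps)
  finally show ?thesis .
qed

lemma expectation_vertex_law:
  "measure_pmf.expectation (vertex_law h) f = (\<Sum>w\<in>V. pmf (vertex_law h) w * f w)" for f :: "'a \<Rightarrow> real"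
  using set_vertex_law finite_V by (subst integral_measure_pmf_real[of V]) (auto simp: mult.commute)

section \<open>Recovering the loads from the state\<close>

lemma state_snoc: "state (h @ [x]) = step (state h) (snd x)"
  by (simp add: state_def)

lemma set_process: "h \<in> set_pmf (process E strategy t) \<Longrightarrow> x \<in> set h \<Longrightarrow> snd x \<in> V"
proof (induction t arbitrary: h)
  case (Suc t)
  then obtain h' e v where h: "h' \<in> set_pmf (process E strategy t)" "e \<in> E" "v \<in> set_pmf (strategy h' e)" "h = h' @ [(e, v)]"
    using E_ne finite_E by auto
  then have "v \<in> V" using set_strategy edge(1) by blast
  then show ?case using Suc.IH[OF h(1)] Suc.prems h by auto
qed simp

lemma length_process: "h \<in> set_pmf (process E strategy t) \<Longrightarrow> length h = t"
  by (induction t arbitrary: h) auto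

text \<open>An invariant of the history. In one step \<open>resolution\<close> turns the new terms
  \<open>r p w\<close> into the centred indicator of the vertex hit, while the subtracted means and
  drifts sum to \<open>- \<beta> * D\<close> and \<open>\<beta> * D\<close> and cancel.\<close>

lemma load_deviation:
  assumes "\<And>x. x \<in> set h \<Longrightarrow> snd x \<in> V" and v: "v \<in> V"
  shows "load h v - length h / n = (\<Sum>p\<in>P. state h p * r p v / \<rho> p) / N"
  using assms(1)
proof (induction h rule: rev_induct)
  case Nil
  then show ?case by (simp add: load_def state_def)
next
  case (snoc x h)
  define z w where "z = state h" and "w = snd x"
  have w: "w \<in> V" using snoc.prems by (simp add: w_def)
  define D where "D = (\<Sum>p\<in>P. sign (z p) * r p v)"
  have "(\<Sum>p\<in>P. mean z p * r p v / \<rho> p) = (\<Sum>u\<in>V. landing z u * (\<Sum>p\<in>P. r p u * r p v / \<rho> p))"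
    unfolding mean_def sum_distrib_left sum_distrib_right sum_divide_distrib
    by (subst sum.swap) (simp add: mult.assoc)
  also have "\<dots> = (\<Sum>u\<in>V. landing z u * (N * (of_bool (u = v) - 1 / n)))"
    using resolution[OF _ v] by simp
  also have "\<dots> = N * (landing z v - (\<Sum>u\<in>V. landing z u) / n)"
  proof -
    have eq: "landing z u * (N * (of_bool (u = v) - 1 / n))
      = N * ((if u = v then landing z v else 0) - landing z u / n)" for u
      by (simp add: algebra_simps)
    then show ?thesis
      unfolding eq using v finite_V by (simp add: sum_subtractf flip: sum_distrib_left sum_divide_distrib)
  qed
  also have "(\<Sum>u\<in>V. landing z u) = 1"
  proof -
    have "(\<Sum>u\<in>V. \<Sum>p\<in>P. sign (z p) * r p u) = 0"
      using sum_r by (subst sum.swap) (simp flip: sum_distrib_left)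
    then show ?thesis using n_pos by (simp add: landing_def sum_subtractf flip: sum_divide_distrib)
  qed
  \<comment> \<open>Since \<open>landing\<close> has total mass 1, its uniform part disappears and
    only the flows remain.\<close>
  finally have 1: "(\<Sum>p\<in>P. mean z p * r p v / \<rho> p) = - N * D / (2 * Q * m)"
    by (simp add: landing_def D_def)
  have 2: "(\<Sum>p\<in>P. sign (z p) * (\<beta> * \<rho> p) * r p v / \<rho> p) = \<beta> * D"
  proof -
    have "sign (z p) * (\<beta> * \<rho> p) * r p v / \<rho> p = \<beta> * (sign (z p) * r p v)" if "p \<in> P" for p
      using \<rho>_eq_0[OF that _ v] by (cases "\<rho> p = 0") auto
    then show ?thesis by (simp add: D_def sum_distrib_left)
  qed
  have "(\<Sum>p\<in>P. step z w p * r p v / \<rho> p) = (\<Sum>p\<in>P. z p * r p v / \<rho> p) + (\<Sum>p\<in>P. r p w * r p v / \<rho> p)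
    - (\<Sum>p\<in>P. mean z p * r p v / \<rho> p) - (\<Sum>p\<in>P. sign (z p) * (\<beta> * \<rho> p) * r p v / \<rho> p)"
    unfolding step_def sum_subtractf[symmetric] sum.distrib[symmetric]
    by (intro sum.cong) (auto simp: algebra_simps diff_divide_distrib add_divide_distrib)
  also have "\<dots> = (\<Sum>p\<in>P. z p * r p v / \<rho> p) + N * (of_bool (w = v) - 1 / n)"
    unfolding 1 2 resolution[OF w v] by (simp add: \<beta>_def)
  finally have "(\<Sum>p\<in>P. step z w p * r p v / \<rho> p) / N = (\<Sum>p\<in>P. z p * r p v / \<rho> p) / N + (of_bool (w = v) - 1 / n)"
    using N_pos by (simp add: add_divide_distrib)
  moreover have "real (load (h @ [x]) v) - length (h @ [x]) / n = (load h v - length h / n) + (of_bool (w = v) - 1 / n)"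
    by (simp add: load_def w_def add_divide_distrib)
  ultimately show ?case using snoc by (simp add: state_snoc z_def w_def)
qed

lemma gap_le:
  assumes h: "h \<in> set_pmf (process E strategy t)" and s: "\<And>p. p \<in> P \<Longrightarrow> \<bar>state h p\<bar> \<le> s" "s \<ge> 0"
  shows "gap V h \<le> 2 * \<Lambda> * s"
proof -
  have dev: "\<bar>load h v - t / n\<bar> \<le> \<Lambda> * s" if v: "v \<in> V" for v
  proof -
    have "\<bar>\<Sum>p\<in>P. state h p * r p v / \<rho> p\<bar> \<le> (\<Sum>p\<in>P. \<bar>state h p * r p v / \<rho> p\<bar>)" by (rule sum_abs)
    also have "\<dots> \<le> (\<Sum>p\<in>P. s * (\<bar>r p v\<bar> / \<rho> p))"
      using s \<rho>_nonneg by (intro sum_mono) (auto simp: abs_mult intro!: mult_right_mono divide_right_mono)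
    also have "\<dots> \<le> s * (N * \<Lambda>)"
      unfolding sum_distrib_left[symmetric] by (intro mult_left_mono sum_abs_r v s)
    finally have "\<bar>(\<Sum>p\<in>P. state h p * r p v / \<rho> p) / N\<bar> \<le> \<Lambda> * s"
      using N_pos by (simp add: field_simps)
    then show ?thesis
      using load_deviation[of h v] set_process[OF h] length_process[OF h] v by simp
  qed
  have "Max (load h ` V) \<in> load h ` V" "Min (load h ` V) \<in> load h ` V"
    using finite_V V_ne by (auto intro!: Max_in Min_in)
  then obtain u v where uv: "u \<in> V" "v \<in> V" "Max (load h ` V) = load h u" "Min (load h ` V) = load h v"
    by auto
  moreover have "load h v \<le> load h u" using uv finite_V by (metis Min_le finite_imageI imageI)
  ultimately show ?thesis using dev[of u] dev[of v] by (simp add: gap_def of_nat_diff)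
qed

text \<open>The scale at which noise and drift match: with variance at most
  \<open>2 * \<rho> p / n\<close> and drift \<open>\<beta> * \<rho> p\<close>, the equation
  \<open>a * (2 / n) = \<beta> / 2\<close> makes both fit the same
  \<open>\<theta> = a * \<beta> * \<rho> p / 2\<close>.\<close>

definition a :: real where "a = \<beta> * n / 4"

lemma \<beta>_pos: "\<beta> > 0" and a_pos: "a > 0"
proof -
  show "\<beta> > 0" using N_pos Q_pos m_pos by (simp add: \<beta>_def)
  then show "a > 0" using n_pos by (simp add: a_def)
qed

lemma vertex_law_potential:
  assumes p: "p \<in> P" and a: "a \<le> 1 / 2"
  defines "\<theta> \<equiv> a * \<beta> * \<rho> p / 2"
  shows "0 \<le> \<theta>" "\<theta> \<le> 1" and "measure_pmf.expectation (vertex_law h) (\<lambda>v. potential a (step (state h) v p))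
    \<le> (1 - \<theta> / 2) * potential a (state h p) + 82 * \<theta>"
proof -
  let ?M = "vertex_law h"
  let ?X = "\<lambda>v. r p v - mean (state h) p"
  have int: "integrable (measure_pmf ?M) f" for f :: "'a \<Rightarrow> real"
    by (rule integrable_measure_pmf_finite[OF finite_vertex_law])
  have mean_eq: "mean (state h) p = measure_pmf.expectation ?M (r p)"
    by (simp add: expectation_vertex_law mean_def pmf_vertex_law)
  have mean0: "measure_pmf.expectation ?M ?X = 0"
    by (simp add: mean_eq int)
  \<comment> \<open>The variance is at most the second moment, which is controlled by the bound
    \<open>2 / n\<close> on the law.\<close>
  have "measure_pmf.expectation ?M (\<lambda>v. (?X v)\<^sup>2)
      = measure_pmf.expectation ?M (\<lambda>v. (r p v)\<^sup>2) - (mean (state h) p)\<^sup>2"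
    using measure_pmf.variance_eq[of ?M "r p"] int by (simp add: mean_eq)
  also have "\<dots> \<le> measure_pmf.expectation ?M (\<lambda>v. (r p v)\<^sup>2)" by simp
  also have "\<dots> \<le> (\<Sum>v\<in>V. 2 / n * (r p v)\<^sup>2)"
    unfolding expectation_vertex_law using pmf_vertex_law_le by (intro sum_mono mult_right_mono) auto
  also have "\<dots> \<le> 2 / n * \<rho> p"
    using sum_r_square[OF p] by (simp add: divide_right_mono flip: sum_distrib_left sum_divide_distrib)
  finally have second: "a\<^sup>2 * measure_pmf.expectation ?M (\<lambda>v. (?X v)\<^sup>2) \<le> a\<^sup>2 * (2 / n * \<rho> p)"
    by (rule mult_left_mono) simp
  have a_eq: "a * (2 / n) = \<beta> / 2" using n_pos by (simp add: a_def)
  have "a\<^sup>2 * (2 / n * \<rho> p) = a * (a * (2 / n)) * \<rho> p" by (simp add: power2_eq_square)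
  also have "\<dots> = \<theta>" unfolding a_eq by (simp add: \<theta>_def)
  finally have second': "a\<^sup>2 * measure_pmf.expectation ?M (\<lambda>v. (?X v)\<^sup>2) \<le> \<theta>" using second by simp
  show \<theta>0: "0 \<le> \<theta>" using a_pos \<beta>_pos \<rho>_nonneg[OF p] by (simp add: \<theta>_def)
  have "\<beta> \<le> \<beta> * n" using \<beta>_pos n_pos by (simp add: mult_le_cancel_left1)
  also have "\<dots> = 4 * a" by (simp add: a_def)
  finally have \<beta>2: "\<beta> \<le> 2" using a by simp
  have "a * \<beta> * \<rho> p \<le> (1 / 2) * 2 * 2"
    using a \<beta>2 \<rho>_le[OF p] \<rho>_nonneg[OF p] a_pos \<beta>_pos by (intro mult_mono) auto
  then show \<theta>1: "\<theta> \<le> 1" by (simp add: \<theta>_def)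
  have "\<bar>mean (state h) p\<bar> \<le> (\<Sum>u\<in>V. \<bar>landing (state h) u * r p u\<bar>)"
    unfolding mean_def by (rule sum_abs)
  also have "\<dots> \<le> (\<Sum>u\<in>V. pmf ?M u * 1)"
    using abs_r[OF p] by (intro sum_mono) (simp add: abs_mult mult_left_le flip: pmf_vertex_law[of _ h])
  also have "\<dots> = 1" using sum_pmf_eq_1[OF finite_V set_vertex_law] by simp
  finally have "\<bar>?X v\<bar> \<le> 2" for v using abs_r[OF p, of v] by linarith
  then have "a * \<bar>?X v\<bar> \<le> (1 / 2) * 2" for v using a a_pos by (intro mult_mono) auto
  then have bound: "\<bar>a * ?X v\<bar> \<le> 1" for v using a_pos by (simp add: abs_mult)
  show "measure_pmf.expectation ?M (\<lambda>v. potential a (step (state h) v p))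
    \<le> (1 - \<theta> / 2) * potential a (state h p) + 82 * \<theta>"
    unfolding step_def
    by (rule expectation_potential_le[OF finite_vertex_law mean0 second' bound \<theta>0 \<theta>1 _ a_pos])
       (simp add: \<theta>_def)
qed

section \<open>Tail bounds uniform in time\<close>

lemma nn_integral_process_Suc:
  fixes f :: "('p \<Rightarrow> real) \<Rightarrow> ennreal"
  shows
  "(\<integral>\<^sup>+ h. f (state h) \<partial>process E strategy (Suc t)) =
   (\<integral>\<^sup>+ h. \<integral>\<^sup>+ v. f (step (state h) v) \<partial>vertex_law h \<partial>process E strategy t)"
  by (simp add: vertex_law_def state_snoc)

text \<open>The value 164 is the fixed point of
  \<open>x \<mapsto> (1 - \<theta> / 2) * x + 82 * \<theta>\<close>, independent of
  \<open>\<theta>\<close>; the initial potential 2 lies below it, so the bound persists for all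
  times.\<close>

lemma nn_integral_potential:
  assumes p: "p \<in> P" and a: "a \<le> 1 / 2"
  shows "(\<integral>\<^sup>+ h. potential a (state h p) \<partial>process E strategy t) \<le> 164"
proof (induction t)
  case 0
  then show ?case by (simp add: state_def potential_def)
next
  case (Suc t)
  define \<eta> where "\<eta> = a * \<beta> * \<rho> p / 2 / 2"
  have \<eta>: "0 \<le> \<eta>" "\<eta> \<le> 1" using vertex_law_potential(1,2)[OF p a] by (auto simp: \<eta>_def)
  have pos: "potential a z \<ge> 0" for z by (simp add: potential_def add_nonneg_nonneg)
  have "(\<integral>\<^sup>+ h. potential a (state h p) \<partial>process E strategy (Suc t)) =
     (\<integral>\<^sup>+ h. \<integral>\<^sup>+ v. potential a (step (state h) v p) \<partial>vertex_law h \<partial>process E strategy t)"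
    using nn_integral_process_Suc[where f = "\<lambda>z. potential a (z p)"] by simp
  also have "\<dots> \<le> (\<integral>\<^sup>+ h. ennreal (1 - \<eta>) * potential a (state h p) + ennreal (164 * \<eta>) \<partial>process E strategy t)"
  proof (rule nn_integral_mono)
    fix h
    have "(\<integral>\<^sup>+ v. potential a (step (state h) v p) \<partial>vertex_law h)
      = ennreal (measure_pmf.expectation (vertex_law h) (\<lambda>v. potential a (step (state h) v p)))"
      by (intro nn_integral_eq_integral integrable_measure_pmf_finite finite_vertex_law) (simp add: pos)
    also have "\<dots> \<le> ennreal ((1 - \<eta>) * potential a (state h p) + 164 * \<eta>)"
      using vertex_law_potential(3)[OF p a, of h] by (intro ennreal_leI) (simp add: \<eta>_def)
    also have "\<dots> = ennreal (1 - \<eta>) * potential a (state h p) + ennreal (164 * \<eta>)"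
      using \<eta> pos by (simp add: ennreal_plus ennreal_mult)
    finally show "(\<integral>\<^sup>+ v. potential a (step (state h) v p) \<partial>vertex_law h)
      \<le> ennreal (1 - \<eta>) * potential a (state h p) + ennreal (164 * \<eta>)" .
  qed
  also have "\<dots> = ennreal (1 - \<eta>) * (\<integral>\<^sup>+ h. potential a (state h p) \<partial>process E strategy t) + ennreal (164 * \<eta>)"
    by (simp add: nn_integral_add nn_integral_cmult measure_pmf.emeasure_space_1[simplified])
  also have "\<dots> \<le> ennreal (1 - \<eta>) * 164 + ennreal (164 * \<eta>)"
    by (intro add_right_mono mult_left_mono Suc.IH) simp
  also have "ennreal (1 - \<eta>) * 164 = ennreal ((1 - \<eta>) * 164)"
    using \<eta> ennreal_mult[of "1 - \<eta>" 164] by (simp only: ennreal_numeral)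
  also have "\<dots> + ennreal (164 * \<eta>) = ennreal ((1 - \<eta>) * 164 + 164 * \<eta>)"
    using \<eta> by (intro ennreal_plus[symmetric]) auto
  also have "\<dots> = 164" by simp
  finally show ?case .
qed

text \<open>Markov's inequality for the potential.\<close>

lemma tail:
  assumes p: "p \<in> P" and a: "a \<le> 1 / 2"
  shows "measure_pmf.prob (process E strategy t) {h. \<bar>state h p\<bar> > s} \<le> 164 * exp (- a * s)"
proof -
  let ?M = "process E strategy t"
  have "emeasure ?M {h. \<bar>state h p\<bar> > s} = (\<integral>\<^sup>+ h. indicator {h. \<bar>state h p\<bar> > s} h \<partial>?M)"
    by simp
  also have "\<dots> \<le> (\<integral>\<^sup>+ h. ennreal (exp (- a * s)) * potential a (state h p) \<partial>?M)"
  proof (rule nn_integral_mono)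
    fix h
    have "1 \<le> exp (- a * s) * potential a (state h p)" if "\<bar>state h p\<bar> > s"
      using mult_left_mono[OF potential_ge[OF a_pos that], of "exp (- a * s)"] by (simp flip: exp_add)
    then show "indicator {h. \<bar>state h p\<bar> > s} h \<le> ennreal (exp (- a * s)) * potential a (state h p)"
      by (auto simp: indicator_def simp flip: ennreal_mult')
  qed
  also have "\<dots> = ennreal (exp (- a * s)) * (\<integral>\<^sup>+ h. potential a (state h p) \<partial>?M)"
    by (simp add: nn_integral_cmult)
  also have "\<dots> \<le> ennreal (exp (- a * s)) * 164"
    by (intro mult_left_mono nn_integral_potential p a) simp
  also have "\<dots> = ennreal (164 * exp (- a * s))" by (simp add: ennreal_mult mult.commute)
  finally show ?thesis by (simp add: measure_pmf.emeasure_eq_measure)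
qed

lemma prob_gap:
  assumes a: "a \<le> 1 / 2" and s: "s \<ge> 0"
  shows "measure_pmf.prob (process E strategy t) {h. gap V h \<le> 2 * \<Lambda> * s}
    \<ge> 1 - real (card P) * (164 * exp (- a * s))"
proof -
  let ?M = "process E strategy t"
  define B where "B = (\<Union>p\<in>P. {h. \<bar>state h p\<bar> > s})"
  have "measure_pmf.prob ?M B \<le> (\<Sum>p\<in>P. measure_pmf.prob ?M {h. \<bar>state h p\<bar> > s})"
    unfolding B_def by (intro measure_pmf.finite_measure_subadditive_finite finite_P) auto
  also have "\<dots> \<le> (\<Sum>p\<in>P. 164 * exp (- a * s))" by (intro sum_mono tail a)
  finally have "1 - real (card P) * (164 * exp (- a * s)) \<le> 1 - measure_pmf.prob ?M B" by simp
  also have "\<dots> = measure_pmf.prob ?M (- B)"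
    using measure_pmf.prob_compl[of B ?M] by (simp add: Compl_eq_Diff_UNIV)
  also have "\<dots> \<le> measure_pmf.prob ?M {h. gap V h \<le> 2 * \<Lambda> * s}"
    using gap_le[OF _ _ s] by (intro measure_pmf.finite_measure_mono_AE)
      (auto simp: AE_measure_pmf_iff B_def not_less)
  finally show ?thesis .
qed

end

section \<open>Strategies from edge-connectivity\<close>

lemma card_lessThan_times: "card ({..<a} \<times> {..<b} \<times> {..<c}) = a * (b * c :: nat)"
  by (simp add: card_cartesian_product)

text \<open>The walks have fewer than \<open>2 * card V\<close> positions, so \<open>J\<close>
  levels merge each line into one block. The polynomial factor in front of the exponential is the
  number of Haar functions, over which a union bound is taken.\<close>

lemma balancing_strategy_exists:
  assumes G: "cut_graph V E k" and reg: "regular_graph V E d" and kd: "k \<le> d"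
    and J: "2 * card V \<le> 2 ^ J"
  shows "\<exists>S. allocation_strategy E S \<and> (\<forall>s\<ge>0. \<forall>t.
    measure_pmf.prob (process E S t) {h. gap V h \<le> 2 * real J * s}
      \<ge> 1 - real (k * card E * J * (2 * card V)) * (164 * exp (- (k / (40 * real d * real J)) * s)))"
proof -
  interpret cut_graph V E k by (rule G)
  define m where "m = card E"
  define N where "N = k * m"
  have d_pos: "d > 0" using k_pos kd by simp
  have "card V > 0" using finite_V nonempty by (simp add: card_gt_0_iff)
  then have "J \<noteq> 0" using J by (intro notI) simp
  then have J_pos: "J > 0" by simp
  have n_pos: "card V > 0" by fact
  have m_pos: "m > 0"
  proof -
    obtain v where "v \<in> V" using nonempty by blast
    then have "{e \<in> E. v \<in> e} \<noteq> {}" using reg d_pos unfolding regular_graph_def by (metis card.empty less_irrefl)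
    then show ?thesis using finite_E by (auto simp: m_def card_gt_0_iff)
  qed
  obtain F where F: "\<And>i. i < N \<Longrightarrow> F i \<subseteq> E" "\<And>i. i < N \<Longrightarrow> spanning V (F i)"
    "\<And>e. e \<in> E \<Longrightarrow> card {i. i < N \<and> e \<in> F i} \<le> 5 * m"
    using spanning_packing unfolding N_def m_def by blast
  have "\<exists>W. set W = V \<and> length W < 2 * card V \<and> set (walk_edges W) \<subseteq> F i
     \<and> (\<forall>e. count_list (walk_edges W) e \<le> 2)" if i: "i < N" for i
  proof -
    have "e \<subseteq> V \<and> card e = 2" if "e \<in> F i" for e
      using F(1)[OF i] that edge_subset card_edge by blast
    from spanning_walk[OF finite_V nonempty F(2)[OF i] this] show ?thesis by metis
  qed
  then obtain W where W: "\<And>i. i < N \<Longrightarrow> set (W i) = V" "\<And>i. i < N \<Longrightarrow> length (W i) < 2 * card V"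
    "\<And>i. i < N \<Longrightarrow> set (walk_edges (W i)) \<subseteq> F i"
    "\<And>i e. i < N \<Longrightarrow> count_list (walk_edges (W i)) e \<le> 2" by metis
  define \<tau> where "\<tau> i = first_index (W i)" for i
  have numbered: "numbered_set V (\<tau> i)" if "i < N" for i
    using finite_V inj_first_index[of "W i"] W(1)[OF that] by (simp add: numbered_set_def \<tau>_def)
  have \<tau>_less: "\<tau> i v < 2 * card V" if "i < N" "v \<in> V" for i v
    using first_index_less[of v "W i"] W(1,2)[OF that(1)] that(2) by (simp add: \<tau>_def)
  define P where "P = {..<N} \<times> {..<J} \<times> {..<2 * card V}"
  define r where "r = (\<lambda>(i, j, b). numbered_set.haar V (\<tau> i) j b)"
  define \<rho> where "\<rho> = (\<lambda>(i, j, b). numbered_set.haar_norm V (\<tau> i) j b)"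
  define H where "H = (\<lambda>(i, jb). walk_flow (W i) (r (i, jb)))"
  have sum_P: "(\<Sum>p\<in>P. f p) = (\<Sum>i<N. \<Sum>j<J. \<Sum>b<2 * card V. f (i, j, b))" for f :: "_ \<Rightarrow> real"
    unfolding P_def by (simp add: sum.cartesian_product)
  have sum_P': "(\<Sum>p\<in>P. f p) = (\<Sum>i<N. \<Sum>jb\<in>{..<J} \<times> {..<2 * card V}. f (i, jb))" for f :: "_ \<Rightarrow> real"
    unfolding P_def by (simp add: sum.cartesian_product)
  have count: "real (count_list (walk_edges (W i)) e) \<le> (if e \<in> F i then 2 else 0)" if "i < N" for i e
    using W(3,4)[OF that] by (auto simp: count_list_0_iff subset_iff)
  \<comment> \<open>The capacity \<open>10 * m * J\<close> arises from at most \<open>5 * m\<close>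
    spanning sets through an edge, at most 2 traversals in each, and at most 1 unit for each of
    \<open>J\<close> levels.\<close>
  interpret B: balancing_frame V E d P r \<rho> H "10 * real m * J" "real N" "real J"
  proof
    show "simple_graph V E" "V \<noteq> {}" "regular_graph V E d" "0 < d" by (fact simple nonempty reg d_pos)+
    show "finite P" by (simp add: P_def)
    show "0 < 10 * real m * J" "0 < real N" using m_pos J_pos k_pos by (auto simp: N_def)
    fix p assume "p \<in> P"
    then obtain i j b where p: "p = (i, j, b)" "i < N" by (auto simp: P_def)
    note ns = numbered[OF p(2)]
    show "(\<Sum>v\<in>V. r p v) = 0" using numbered_set.sum_haar[OF ns] by (simp add: r_def p)
    then have r0: "(\<Sum>v\<in>set (W i). r p v) = 0" using W(1)[OF p(2)] by simp
    show "\<bar>r p v\<bar> \<le> 1" for v using numbered_set.abs_haar_le[OF ns] by (simp add: r_def p)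
    show "(\<Sum>v\<in>V. (r p v)\<^sup>2) \<le> \<rho> p" using numbered_set.sum_haar_square_le[OF ns] by (simp add: r_def \<rho>_def p)
    show "\<rho> p \<le> 2" using numbered_set.haar_norm_le[OF ns] by (simp add: \<rho>_def p)
    show "(\<Sum>w\<in>e. H p e w) = 0" if "e \<in> E" for e
      using sum_walk_flow_edge[OF finite_subset[OF edge_subset[OF that] finite_V]] by (simp add: H_def p)
    show "(\<Sum>e\<in>{e \<in> E. w \<in> e}. H p e w) = - r p w" if "w \<in> V" for w
      using sum_walk_flow_vertex[OF finite_E _ _ r0, of w] W(1,3)[OF p(2)] F(1)[OF p(2)] that
      by (auto simp: H_def p)
  next
    fix v assume v: "v \<in> V"
    have "(\<Sum>p\<in>P. \<bar>r p v\<bar> / \<rho> p) \<le> (\<Sum>i<N. \<Sum>j<J. 1)"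
      unfolding sum_P using numbered_set.sum_abs_haar_le[OF numbered v]
      by (intro sum_mono) (simp add: r_def \<rho>_def)
    then show "(\<Sum>p\<in>P. \<bar>r p v\<bar> / \<rho> p) \<le> real N * real J" by simp
  next
    fix u v assume uv: "u \<in> V" "v \<in> V"
    have "(\<Sum>p\<in>P. r p u * r p v / \<rho> p) = (\<Sum>i<N. of_bool (u = v) - 1 / card V)"
      unfolding sum_P using numbered_set.haar_resolution[OF numbered uv \<tau>_less J]
      by (intro sum.cong) (auto simp: r_def \<rho>_def)
    then show "(\<Sum>p\<in>P. r p u * r p v / \<rho> p) = real N * (of_bool (u = v) - 1 / card V)" by simp
  next
    fix e w assume e: "e \<in> E" "w \<in> e"
    have "(\<Sum>jb\<in>{..<J} \<times> {..<2 * card V}. \<bar>H (i, jb) e w\<bar>) \<le> real J * (if e \<in> F i then 2 else 0)"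
      if i: "i < N" for i
    proof -
      have prefix: "(\<Sum>jb\<in>{..<J} \<times> {..<2 * card V}. \<bar>prefix_sum (W i) (r (i, jb)) s\<bar>)
        = (\<Sum>j<J. \<Sum>b<2 * card V. \<bar>\<Sum>v\<in>{v \<in> V. \<tau> i v \<le> s}. numbered_set.haar V (\<tau> i) j b v\<bar>)" for s
        by (simp add: sum.cartesian_product prefix_sum_def r_def \<tau>_def W(1)[OF i] case_prod_unfold)
      have "(\<Sum>j<J. \<Sum>b<2 * card V. \<bar>\<Sum>v\<in>{v \<in> V. \<tau> i v \<le> s}. numbered_set.haar V (\<tau> i) j b v\<bar>)
        \<le> (\<Sum>j<J. 1)" for s
        by (intro sum_mono numbered_set.sum_abs_prefix_haar_le numbered i)
      then have "(\<Sum>jb\<in>{..<J} \<times> {..<2 * card V}. \<bar>walk_flow (W i) (r (i, jb)) e w\<bar>)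
        \<le> real J * count_list (walk_edges (W i)) e"
        by (intro sum_abs_walk_flow_le) (auto simp: prefix)
      also have "\<dots> \<le> real J * (if e \<in> F i then 2 else 0)" by (intro mult_left_mono count i) simp
      finally show ?thesis by (simp add: H_def)
    qed
    then have "(\<Sum>p\<in>P. \<bar>H p e w\<bar>) \<le> (\<Sum>i<N. real J * (if e \<in> F i then 2 else 0))"
      unfolding sum_P' by (intro sum_mono) auto
    also have "\<dots> = 2 * real J * card {i. i < N \<and> e \<in> F i}"
      by (simp add: sum.If_cases Int_def if_distrib cong: if_cong)
    also have "\<dots> \<le> 2 * real J * real (5 * m)"
      using F(3)[OF e(1)] by (intro mult_left_mono) (auto simp del: of_nat_mult)
    finally show "(\<Sum>p\<in>P. \<bar>H p e w\<bar>) \<le> 10 * real m * real J" by (simp add: algebra_simps)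
  qed
  \<comment> \<open>Here \<open>\<beta> = k / (20 * m * J)\<close>; the handshake identity then
    replaces \<open>card V / m\<close> by \<open>2 / d\<close>.\<close>
  have "B.a = real k * card V / (80 * m * J)"
    unfolding B.a_def B.\<beta>_def using m_pos J_pos by (simp add: N_def flip: m_def)
  also have "\<dots> = k / (40 * d * J)"
    using arg_cong[OF B.handshake, of real] n_pos m_pos d_pos J_pos
    by (simp add: field_simps flip: m_def)
  finally have a: "B.a = k / (40 * d * J)" .
  have "real k \<le> real d * real J"
    using kd J_pos by (simp add: order_trans[OF _ mult_right_mono[of 1]] flip: of_nat_mult) (metis mult_le_mono nat_mult_1_right Suc_leI One_nat_def)
  then have "real k \<le> 20 * (real d * real J)" using k_pos by linarith
  then have "B.a \<le> 1 / 2" unfolding a using d_pos J_pos by (simp add: divide_le_eq mult.commute)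
  from B.prob_gap[OF this] have "1 - real (k * card E * J * (2 * card V)) * (164 * exp (- (k / (40 * real d * real J)) * s))
    \<le> measure_pmf.prob (process E B.strategy t) {h. gap V h \<le> 2 * real J * s}" if "s \<ge> 0" for s t
    using that unfolding a by (simp add: P_def card_lessThan_times N_def m_def mult.assoc)
  then show ?thesis using B.allocation_strategy by auto
qed

text \<open>The number of Haar functions is at most \<open>10 * n ^ 5\<close>, which the five extra
  powers in the tail absorb.\<close>

lemma powr_bound:
  assumes "n > 0" "k \<le> n" "m \<le> n ^ 2" "real J \<le> 5 * real n"
  shows "real (k * m * J * (2 * n)) * (164 * real n powr - (c + 5)) \<le> 1640 * real n powr - c"
proof -
  have "real (k * m * J * (2 * n)) = real (k * m) * real J * (2 * real n)" by simp
  also have "\<dots> \<le> real (n * n ^ 2) * (5 * real n) * (2 * real n)"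
    using assms mult_le_mono[OF assms(2,3)] by (intro mult_mono) (auto simp only: of_nat_le_iff, auto)
  also have "\<dots> = 10 * real n ^ 5" by (simp add: power_numeral_reduce)
  finally have "real (k * m * J * (2 * n)) * (164 * real n powr - (c + 5)) \<le> 10 * real n ^ 5 * (164 * real n powr - (c + 5))"
    by (intro mult_right_mono) auto
  also have "\<dots> = 1640 * (real n powr 5 * real n powr - (c + 5))"
    using assms(1) powr_realpow[of "real n" 5] by simp
  also have "real n powr 5 * real n powr - (c + 5) = real n powr - c"
    by (subst powr_add[symmetric]) simp
  finally show ?thesis .
qed

theorem theorem1:
  "\<exists>C K :: real \<Rightarrow> real.
     \<forall>(V :: 'a set) (E :: 'a set set) (n :: nat) (d :: nat) (k :: nat).
       simple_graph V E \<and> card V = n \<and> regular_graph V E d \<and>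
       edge_connectivity V E = k \<and> k \<ge> 1 \<longrightarrow>
       (\<exists>S :: 'a strategy. allocation_strategy E S \<and>
         (\<forall>c > 0. \<forall>t :: nat.
            measure_pmf.prob (process E S t)
              {h. real (gap V h) \<le> C c * (real d / real k) * ln (real n) ^ 4 * ln (ln (real n))}
            \<ge> 1 - K c * real n powr (- c)))"
proof -
  \<comment> \<open>In \<open>C\<close>, \<open>2000 = 80 * 5 ^ 2\<close> comes from
    \<open>2 * J * s\<close> with \<open>J \<le> 5 * ln n\<close>, and dividing by
    \<open>ln (ln 3)\<close> makes the double logarithm at least 1 for \<open>n \<ge> 3\<close>. In
    \<open>K\<close>, \<open>1640 = 164 * 10\<close> comes from the union bound, and
    \<open>2 powr c\<close> makes the claim trivial for \<open>n = 2\<close>.\<close>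
  define C K :: "real \<Rightarrow> real"
    where "C = (\<lambda>c. 2000 * (c + 5) / ln (ln 3))" and "K = (\<lambda>c. 1640 + 2 powr c)"
  show ?thesis
  proof (rule exI[of _ C], rule exI[of _ K], intro allI impI)
    fix V :: "'a set" and E n d k
    assume *: "simple_graph V E \<and> card V = n \<and> regular_graph V E d \<and>
         edge_connectivity V E = k \<and> k \<ge> 1"
    then have G: "simple_graph V E" and n: "card V = n" and reg: "regular_graph V E d"
      and conn: "edge_connectivity V E = k" and k: "k \<ge> 1" by auto
    have n2: "n \<ge> 2" using conn k n by (auto simp: edge_connectivity_def split: if_splits)
    then have ne: "V \<noteq> {}" using n by auto
    interpret cut_graph V E k
      using edge_connectivity_le_cut[OF G conn k] by unfold_locales (use G ne k in auto)
    obtain v where v: "v \<in> V" using ne by blast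
    \<comment> \<open>The cut around a single vertex shows that \<open>k\<close> is at most the
      degree.\<close>
    have "k \<le> card {e \<in> E. crosses {v} e}"
      using v n2 n by (intro cut) auto
    also have "\<dots> \<le> card {e \<in> E. v \<in> e}" using finite_E by (intro card_mono) (auto simp: crosses_def)
    also have "\<dots> = d" using reg v by (simp add: regular_graph_def)
    finally have kd: "k \<le> d" .
    have "{e \<in> E. v \<in> e} \<subseteq> (\<lambda>u. {v, u}) ` V"
    proof
      fix e assume e: "e \<in> {e \<in> E. v \<in> e}"
      then obtain u where "e = {v, u}" using card_edge[of e] by (auto simp: card_2_iff)
      then show "e \<in> (\<lambda>u. {v, u}) ` V" using e edge_subset by blast
    qed
    then have "card {e \<in> E. v \<in> e} \<le> card ((\<lambda>u. {v, u}) ` V)" using finite_V by (intro card_mono) auto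
    also have "\<dots> \<le> n" using card_image_le[OF finite_V] n by metis
    finally have dn: "d \<le> n" using reg v by (simp add: regular_graph_def)
    have m_le: "card E \<le> n ^ 2"
    proof -
      have "E \<subseteq> (\<lambda>(u, v). {u, v}) ` (V \<times> V)"
      proof
        fix e assume e: "e \<in> E"
        then obtain x y where "e = {x, y}" using card_edge[of e] by (auto simp: card_2_iff)
        then show "e \<in> (\<lambda>(u, v). {u, v}) ` (V \<times> V)" using edge_subset[OF e] by auto
      qed
      then have "card E \<le> card (V \<times> V)" using finite_V by (intro surj_card_le) auto
      then show ?thesis using n by (simp add: card_cartesian_product power2_eq_square)
    qed
    define J where "J = nat \<lceil>log 2 (2 * n)\<rceil>"
    have log_nonneg: "0 \<le> log 2 (2 * n)" using n2 by (simp add: le_log_iff)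
    have J: "2 * card V \<le> 2 ^ J"
    proof -
      have "log 2 (2 * n) \<le> real J" unfolding J_def by linarith
      then have "real (2 * n) \<le> 2 powr J" using n2 by (simp add: log_le_iff)
      also have "\<dots> = real (2 ^ J)" by (simp add: powr_realpow)
      finally show ?thesis unfolding n by (simp only: of_nat_le_iff)
    qed
    \<comment> \<open>The strategy is fixed before \<open>c\<close>; only the threshold
      \<open>s\<close> will depend on \<open>c\<close>.\<close>
    obtain S where S: "allocation_strategy E S"
      "\<And>s t. s \<ge> 0 \<Longrightarrow> measure_pmf.prob (process E S t) {h. gap V h \<le> 2 * real J * s}
         \<ge> 1 - real (k * card E * J * (2 * n)) * (164 * exp (- (k / (40 * real d * real J)) * s))"
      using balancing_strategy_exists[OF cut_graph_axioms reg kd J, unfolded n] by auto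
    show "\<exists>S :: 'a strategy. allocation_strategy E S \<and>
           (\<forall>c > 0. \<forall>t :: nat.
              measure_pmf.prob (process E S t)
                {h. real (gap V h) \<le> C c * (real d / real k) * ln (real n) ^ 4 * ln (ln (real n))}
              \<ge> 1 - K c * real n powr (- c))"
    proof (intro exI[of _ S] conjI allI impI S(1))
      fix c :: real and t :: nat
      assume c: "c > 0"
      show "1 - K c * real n powr (- c) \<le> measure_pmf.prob (process E S t)
                {h. real (gap V h) \<le> C c * (real d / real k) * ln (real n) ^ 4 * ln (ln (real n))}"
      \<comment> \<open>For \<open>n = 2\<close> the bound on the gap is negative, and the claim holds because of the choice of \<open>K\<close>.\<close>
      proof (cases "n = 2")
        case True
        then have "K c * real n powr (- c) \<ge> 2 powr c * 2 powr (- c)"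
          unfolding K_def by (intro mult_mono) auto
        also have "2 powr c * 2 powr (- c) = (1::real)" by (simp flip: powr_add)
        finally show ?thesis using measure_nonneg[of "process E S t"] by (smt (verit))
      next
        case False
        then have n3: "real n \<ge> 3" using n2 by simp
        have ln_n: "ln 3 \<le> ln (real n)" using n3 by simp
        then have ln1: "ln (real n) \<ge> 1" using ln3_gt_1 by linarith
        have lnln3: "ln (ln 3) > (0::real)" using ln3_gt_1 by simp
        have lnln: "ln (ln 3) \<le> ln (ln (real n))" using ln_n ln3_gt_1 by (subst ln_le_cancel_iff) auto
        have J_le: "real J \<le> 5 * ln (real n)"
        proof -
          have "real J \<le> log 2 (2 * n) + 1" unfolding J_def using log_nonneg by linarith
          also have "log 2 (2 * n) = 1 + ln (real n) / ln 2" using n3 by (simp add: log_mult log_def[of 2 "real n"])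
          also have "ln (real n) / ln 2 \<le> ln (real n) / (2 / 3)"
            using ln2_ge_two_thirds ln1 by (intro divide_left_mono) auto
          finally show ?thesis using ln1 by simp
        qed
        have J_pos: "J > 0" using J n2 n by (intro gr0I) auto
        have dk: "real d / real k > 0" using k kd by simp
        \<comment> \<open>This choice makes the exponential tail equal to
          \<open>n powr - (c + 5)\<close>.\<close>
        define s where "s = (c + 5) * ln (real n) * (40 * d * J / k)"
        have s: "s \<ge> 0" unfolding s_def using c ln1 by simp
        have "exp (- (k / (40 * real d * real J)) * s) = real n powr - (c + 5)"
          using J_pos k kd n2 by (simp add: s_def powr_def) (simp add: algebra_simps)
        moreover have "real (k * card E * J * (2 * n)) * (164 * real n powr - (c + 5)) \<le> 1640 * real n powr - c"
        proof (rule powr_bound)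
          show "real J \<le> 5 * real n" using J_le ln_le_minus_one[of "real n"] n2 by simp
        qed (use n2 kd dn m_le in auto)
        moreover have "1640 * real n powr - c \<le> K c * real n powr - c"
          unfolding K_def by (intro mult_right_mono) auto
        ultimately have "1 - K c * real n powr (- c)
          \<le> 1 - real (k * card E * J * (2 * n)) * (164 * exp (- (k / (40 * real d * real J)) * s))"
          by (simp only: diff_left_mono order_trans)
        also have "\<dots> \<le> measure_pmf.prob (process E S t) {h. gap V h \<le> 2 * real J * s}" by (rule S(2)[OF s])
        also have "\<dots> \<le> measure_pmf.prob (process E S t)
                {h. real (gap V h) \<le> C c * (real d / real k) * ln (real n) ^ 4 * ln (ln (real n))}"
        proof -
          have "2 * real J * s = 80 * (c + 5) * (real d / real k) * ln (real n) * (real J)\<^sup>2"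
            by (simp add: s_def power2_eq_square)
          also have "\<dots> \<le> 80 * (c + 5) * (real d / real k) * ln (real n) * (5 * ln (real n))\<^sup>2"
            using c dk ln1 J_le by (intro mult_left_mono power_mono) auto
          also have "\<dots> = 2000 * (c + 5) * (real d / real k) * (ln (real n) ^ 3 * 1)"
            by (simp add: power2_eq_square power3_eq_cube)
          \<comment> \<open>The argument gives a cubic power of the logarithm;
            \<open>ln n \<ge> 1\<close> and \<open>ln (ln n) \<ge> ln (ln 3) > 0\<close> allow the
            larger stated form.\<close>
          also have "\<dots> \<le> 2000 * (c + 5) * (real d / real k) * (ln (real n) ^ 4 * (ln (ln (real n)) / ln (ln 3)))"
            using c dk ln1 lnln lnln3 by (intro mult_left_mono mult_mono power_increasing) auto
          also have "\<dots> = C c * (real d / real k) * ln (real n) ^ 4 * ln (ln (real n))"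
            by (simp add: C_def mult.assoc mult.commute mult.left_commute)
          finally show ?thesis by (intro measure_pmf.finite_measure_mono) auto
        qed
        finally show ?thesis .
      qed
    qed
  qed
qed

end
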